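(* Let $d\ge 2$ and consider a meta-elliptical random vector $U\sim\mathcal{ME}_d(I_d,g)$, with copula density $c$. For $(u,v)\in(0,1)^2$ write $c(u,v)$ for the value of the copula density at $(u,v)$ if $d=2$, and at $(u,v,1/2,\ldots,1/2)$ if $d>2$. Assume that, for every $u\in(0,1)$, the map $v\mapsto\partial_1\ln c(u,v)$ exists and has a finite limit $\chi(u)$ when $v\to 1$, $v<1$. Moreover, assume that $\chi$ is locally Lipschitz on $(0,1)$. For a given measurable map $\psi:\mathbb{R}^+\to\mathbb{R}$ and a given real number $b>0$, consider two couples $(\Sigma_k,g_k)$, $k\in\{1,2\}$, where $\Sigma_k$ is a positive definite correlation matrix and $g_k\in\tilde{\mathcal{G}}_\psi$, that induce the same law of $U$ (i.e. $U\sim\mathcal{ME}_d(\Sigma_k,g_k)$ for $k=1,2$) and that both satisfy $$b=\frac{\pi^{(d-1)/2}}{\Gamma((d-1)/2)}\int_0^{+\infty}g_k(s)\,s^{(d-3)/2}\,ds .$$ Then these couples are essentially unique: $\Sigma_1=\Sigma_2$ and $g_1=g_2$ on their common support $\mathbb{R}^+$.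
   Context: A density generator in dimension $d$ is a measurable function $g:\mathbb{R}^+\to\mathbb{R}^+\cup\{+\infty\}$ such that $\frac{s_d}{2}\int_0^\infty t^{d/2-1}g(t)\,dt=1$, where $s_d=2\pi^{d/2}/\Gamma(d/2)$. For $\mu\in\mathbb{R}^d$ and a positive definite matrix $\Omega$, the elliptical distribution $\mathcal{E}_d(\mu,\Omega,g)$ is the law on $\mathbb{R}^d$ with Lebesgue density $x\mapsto|\Omega|^{-1/2}g\big((x-\mu)^\top\Omega^{-1}(x-\mu)\big)$. For a positive definite correlation matrix $\Sigma$ (i.e. with unit diagonal), $\mathcal{ME}_d(\Sigma,g)$ denotes the meta-elliptical copula, i.e. the (unique) copula of $\mathcal{E}_d(0,\Sigma,g)$; $U\sim\mathcal{ME}_d(\Sigma,g)$ means that the joint cdf of $U$ on $[0,1]^d$ is this copula. All margins of $\mathcal{E}_d(0,\Sigma,g)$ have the same density $f_g(t)=\frac{\pi^{(d-1)/2}}{\Gamma((d-1)/2)}\int_0^{+\infty}g(t^2+s)s^{(d-3)/2}\,ds$, $t\in\mathbb{R}$, with cdf $F_g(x)=\int_{-\infty}^x f_g(t)\,dt$ and quantile function $Q_g(u)=\inf\{x: F_g(x)\ge u\}$. The density of the copula $\mathcal{ME}_d(\Sigma,g)$ is $$c(u)=\frac{g\big(\vec Q_g(u)\,\Sigma^{-1}\,\vec Q_g(u)^\top\big)}{|\Sigma|^{1/2}\prod_{k=1}^d f_g(Q_g(u_k))},\qquad \vec Q_g(u)=[Q_g(u_1),\ldots,Q_g(u_d)],\quad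 u\in(0,1)^d .$$ The set $\mathcal{G}$ of regular density generators consists of the density generators $g$ (satisfying the normalization above) such that, setting $a_g:=\sup\{t: t>0,\ g(t^2)>0\}\in(0,+\infty]$: the map $t\mapsto g(t^2)$ from $\mathbb{R}$ to $\mathbb{R}^+$ is strictly positive and differentiable on $(-a_g,a_g)$; and the map $t\mapsto\int_0^{+\infty}g(t^2+r^2)r^{d-2}\,dr$ is finite and differentiable on $\mathbb{R}$. For a measurable map $\psi:\mathbb{R}^+\to\mathbb{R}$, $\tilde{\mathcal{G}}_\psi$ denotes the set of density generators $g:\mathbb{R}^+\to\mathbb{R}^+$ that belong to $\mathcal{G}$ with $a_g=+\infty$ and such that, for every $x\in\mathbb{R}$, the map $y\mapsto(g'/g)(x^2+y^2)$ has the finite limit $\psi(x^2)$ when $y\to+\infty$. *)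

theory Defs
  imports "HOL-Probability.Probability"
begin

text \<open>
  Generators are functions on \<open>[0, \<infinity>)\<close> with values in \<open>[0, \<infinity>]\<close>; they are modelled as
  functions \<open>real \<Rightarrow> ennreal\<close> whose values on negative arguments are never used.
  All integrals of nonnegative functions are taken in \<open>ennreal\<close>, so that finiteness is an
  explicit statement.
\<close>

definition sphere_area :: "nat \<Rightarrow> real" where
  "sphere_area d = 2 * pi powr (real d / 2) / Gamma (real d / 2)"

definition density_generator :: "nat \<Rightarrow> (real \<Rightarrow> ennreal) \<Rightarrow> bool" where
  "density_generator d g \<longleftrightarrow>
     g \<in> borel_measurable (restrict_space borel {0..}) \<and>
     ennreal (sphere_area d / 2) *
       (\<integral>\<^sup>+t\<in>{0<..}. ennreal (t powr (real d / 2 - 1)) * g t \<partial>lborel) = 1"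

definition pos_def_matrix :: "real^'n^'n \<Rightarrow> bool" where
  "pos_def_matrix A \<longleftrightarrow> transpose A = A \<and> (\<forall>x. x \<noteq> 0 \<longrightarrow> 0 < x \<bullet> (A *v x))"

definition correlation_matrix :: "real^'n^'n \<Rightarrow> bool" where
  "correlation_matrix A \<longleftrightarrow> pos_def_matrix A \<and> (\<forall>k. A $ k $ k = 1)"

definition elliptical ::
    "real^'n \<Rightarrow> real^'n^'n \<Rightarrow> (real \<Rightarrow> ennreal) \<Rightarrow> (real^'n) measure" where
  "elliptical \<mu> \<Omega> g = density lborel
     (\<lambda>x. ennreal (1 / sqrt (det \<Omega>)) * g ((x - \<mu>) \<bullet> (matrix_inv \<Omega> *v (x - \<mu>))))"

definition joint_cdf :: "(real^'n) measure \<Rightarrow> real^'n \<Rightarrow> real" where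
  "joint_cdf P x = measure P {y. \<forall>k. y $ k \<le> x $ k}"

definition margin :: "(real^'n) measure \<Rightarrow> 'n \<Rightarrow> real measure" where
  "margin P k = distr P borel (\<lambda>x. x $ k)"

text \<open>
  A copula is the restriction to the unit cube of the cdf of a law with uniform margins.
  Values of \<open>C\<close> outside the unit cube are irrelevant below.
\<close>

definition copula :: "(real^'n \<Rightarrow> real) \<Rightarrow> bool" where
  "copula C \<longleftrightarrow> (\<exists>P. prob_space P \<and> sets P = sets borel \<and>
     (\<forall>k. margin P k = uniform_measure lborel {0..1}) \<and>
     (\<forall>u. (\<forall>k. u $ k \<in> {0..1}) \<longrightarrow> C u = joint_cdf P u))"

text \<open>
  Sklar's relation. For a law \<open>P\<close> with continuous marginal cdfs, such as an elliptical one, it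
  determines \<open>C\<close> uniquely on the unit cube.
\<close>

definition copula_of :: "(real^'n) measure \<Rightarrow> (real^'n \<Rightarrow> real) \<Rightarrow> bool" where
  "copula_of P C \<longleftrightarrow>
     copula C \<and> (\<forall>x. joint_cdf P x = C (\<chi> k. cdf (margin P k) (x $ k)))"

definition meta_elliptical ::
    "'a measure \<Rightarrow> ('a \<Rightarrow> real^'n) \<Rightarrow> real^'n^'n \<Rightarrow> (real \<Rightarrow> ennreal) \<Rightarrow> bool" where
  "meta_elliptical M U \<Sigma> g \<longleftrightarrow>
     prob_space M \<and> U \<in> borel_measurable M \<and>
     copula_of (elliptical 0 \<Sigma> g) (joint_cdf (distr M borel U))"

definition marginal_density :: "nat \<Rightarrow> (real \<Rightarrow> ennreal) \<Rightarrow> real \<Rightarrow> ennreal" where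
  "marginal_density d g t =
     ennreal (pi powr ((real d - 1) / 2) / Gamma ((real d - 1) / 2)) *
       (\<integral>\<^sup>+s\<in>{0<..}. g (t\<^sup>2 + s) * ennreal (s powr ((real d - 3) / 2)) \<partial>lborel)"

definition marginal_cdf :: "nat \<Rightarrow> (real \<Rightarrow> ennreal) \<Rightarrow> real \<Rightarrow> real" where
  "marginal_cdf d g x = enn2real (\<integral>\<^sup>+t\<in>{..x}. marginal_density d g t \<partial>lborel)"

definition marginal_quantile :: "nat \<Rightarrow> (real \<Rightarrow> ennreal) \<Rightarrow> real \<Rightarrow> real" where
  "marginal_quantile d g u = Inf {x. u \<le> marginal_cdf d g x}"

definition quantile_vec :: "(real \<Rightarrow> ennreal) \<Rightarrow> real^'n \<Rightarrow> real^'n" where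
  "quantile_vec g u = (\<chi> k. marginal_quantile CARD('n) g (u $ k))"

text \<open>
  The copula density on the open unit cube. It is \<open>ennreal\<close>-valued since \<open>g\<close> and the marginal
  density may take the value \<open>\<infinity>\<close>; with the \<open>ennreal\<close> conventions for division, the quotient lies
  strictly between \<open>0\<close> and \<open>\<infinity>\<close> exactly if all the factors involved do.
\<close>

definition meta_elliptical_density ::
    "real^'n^'n \<Rightarrow> (real \<Rightarrow> ennreal) \<Rightarrow> real^'n \<Rightarrow> ennreal" where
  "meta_elliptical_density \<Sigma> g u =
     g (quantile_vec g u \<bullet> (matrix_inv \<Sigma> *v quantile_vec g u)) /
       (ennreal (sqrt (det \<Sigma>)) *
        (\<Prod>k\<in>UNIV. marginal_density CARD('n) g (marginal_quantile CARD('n) g (u $ k))))"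

definition generator_bound :: "(real \<Rightarrow> ennreal) \<Rightarrow> ereal" where
  "generator_bound g = Sup {ereal t | t. 0 < t \<and> 0 < g (t\<^sup>2)}"

definition regular_generator :: "nat \<Rightarrow> (real \<Rightarrow> ennreal) \<Rightarrow> bool" where
  "regular_generator d g \<longleftrightarrow>
     density_generator d g \<and>
     (\<forall>t. g (t\<^sup>2) < \<infinity>) \<and>
     (\<forall>t. ereal \<bar>t\<bar> < generator_bound g \<longrightarrow>
        0 < g (t\<^sup>2) \<and> (\<lambda>t. enn2real (g (t\<^sup>2))) differentiable at t) \<and>
     (\<forall>t. (\<integral>\<^sup>+r\<in>{0<..}. g (t\<^sup>2 + r\<^sup>2) * ennreal (r ^ (d - 2)) \<partial>lborel) < \<infinity>) \<and>
     (\<forall>t. (\<lambda>t. enn2real (\<integral>\<^sup>+r\<in>{0<..}. g (t\<^sup>2 + r\<^sup>2) * ennreal (r ^ (d - 2)) \<partial>lborel))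
        differentiable at t)"

definition regular_generators_lim :: "nat \<Rightarrow> (real \<Rightarrow> real) \<Rightarrow> (real \<Rightarrow> ennreal) set" where
  "regular_generators_lim d \<psi> = {g. regular_generator d g \<and> generator_bound g = \<infinity> \<and>
     (\<forall>x. ((\<lambda>y. deriv (\<lambda>s. enn2real (g s)) (x\<^sup>2 + y\<^sup>2) / enn2real (g (x\<^sup>2 + y\<^sup>2)))
        \<longlongrightarrow> \<psi> (x\<^sup>2)) at_top)}"

definition locally_lipschitz_on :: "real set \<Rightarrow> (real \<Rightarrow> real) \<Rightarrow> bool" where
  "locally_lipschitz_on S f \<longleftrightarrow> (\<forall>x\<in>S. \<exists>r>0. \<exists>L. L-lipschitz_on (ball x r \<inter> S) f)"

text \<open>
  The point with coordinate \<open>u\<close> at index \<open>i\<close>, \<open>v\<close> at index \<open>j\<close>, and \<open>1/2\<close> elsewhere. Two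
  distinct indices play the role of the first two coordinates.
\<close>

definition slice_point :: "'n \<Rightarrow> 'n \<Rightarrow> real \<Rightarrow> real \<Rightarrow> real^'n" where
  "slice_point i j u v = (\<chi> k. if k = i then u else if k = j then v else 1 / 2)"

end

theory Submission
  imports Defs
begin

text \<open>
  Since \<open>U\<close> has the copula of a spherical law, \<open>P(U\<^sub>i \<le> 1/2, U\<^sub>j \<le> 1/2) = 1/4\<close> for \<open>i \<noteq> j\<close>.
  For an elliptical law with a positive generator this quadrant probability differs from \<open>1/4\<close>
  unless the correlation vanishes, so \<open>\<Sigma>1 = \<Sigma>2 = I\<close>. The copula densities built from \<open>g\<close> and
  \<open>g1\<close> agree almost everywhere, and on the slice their ratio does not depend on the first argument,
  so \<open>\<partial>\<^sub>1 ln c\<close> can be computed from \<open>g1\<close>. Letting \<open>v \<rightarrow> 1\<close> yields, for the marginal cdf \<open>F\<close> and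
  density \<open>f\<close> of \<open>g1\<close>, the equation \<open>\<chi>(F(x)) f(x) + f'(x)/f(x) = 2 x \<psi>(x\<^sup>2)\<close>, and likewise for
  \<open>g2\<close>. The unknown \<open>\<psi>\<close> cancels in the difference of both equations: with antiderivatives \<open>X\<close> of
  \<open>\<chi>\<close> and \<open>E\<close> of \<open>exp X\<close>, first \<open>ln f + X(F)\<close> and then \<open>E(F)\<close> coincide, because the initial values
  \<open>F(0) = 1/2\<close> and \<open>f(0) = b\<close> do. Equal margins and equal copulas give equal laws, hence
  \<open>g1 = g2\<close>.
\<close>


section \<open>Radial integrals\<close>

text \<open>Two gaps in regularity shape the proof. The hypotheses on \<open>c\<close> speak of
  \<open>g\<close>, which is only measurable, whereas the limit \<open>\<psi>\<close> concerns
  \<open>g1\<close> and \<open>g2\<close>. Moreover, the common law of \<open>U\<close> relates the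
  densities only up to null sets, while \<open>c\<close> lives on a null set when d > 2. The
  identity on the slice is therefore regained from lines in the full cube, where the density built
  from \<open>g1\<close> is continuous. The quadrant probability detects a correlation because a
  factorization of \<Sigma> that keeps coordinate i turns the quadrant into a wedge. Quadrant and
  wedge are nested, and their difference contains an open cone, which a positive generator charges.
  The equation of the margin comes from ln c = ln g1(Q(u)^2 + Q(v)^2) - ln f(Q(u)) + (terms without
  u) for v > 1/2. Its derivative at u = F(x) is (2 x (g1'/g1)(x^2 + Q(v)^2) - f'(x)/f(x)) / f(x),
  and Q(v) tends to infinity as v tends to 1 because \<open>generator_bound g1\<close> is
  infinite.\<close>

lemma measure_eqI_atMost:
  fixes M N :: "'a::ordered_euclidean_space measure"
  assumes sets: "sets M = sets borel" "sets N = sets borel"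
    and eq: "\<And>x. emeasure M {..x} = emeasure N {..x}"
    and fin: "\<And>x. emeasure M {..x} \<noteq> \<infinity>"
  shows "M = N"
proof (rule measure_eqI_generator_eq_countable[where E = "range atMost" and \<Omega> = UNIV
      and A = "range (\<lambda>n::nat. {..of_nat n *\<^sub>R (\<Sum>Basis :: 'a)})"])
  show "Int_stable (range atMost :: 'a set set)"
    proof (rule Int_stableI_image)
    show "\<exists>k\<in>UNIV. {..i} \<inter> {..j} = {..k}" for i j :: 'a
      by (intro bexI[of _ "inf i j"]) auto
  qed
  show "sets M = sigma_sets UNIV (range atMost)" "sets N = sigma_sets UNIV (range atMost)"
    by (simp_all add: sets borel_eq_atMost)
  show "(\<Union> (range (\<lambda>n::nat. {..of_nat n *\<^sub>R (\<Sum>Basis :: 'a)}))) = UNIV"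
  proof (intro equalityI subsetI UNIV_I)
    fix x :: 'a
    obtain n :: nat where n: "norm x \<le> real n"
      using real_arch_simple by blast
    have "x \<le> of_nat n *\<^sub>R (\<Sum>Basis :: 'a)"
      unfolding eucl_le[where 'a='a] using n
      by (auto simp: inner_sum_left inner_Basis if_distrib cong: if_cong)
        (meson Basis_le_norm abs_le_D1 order_trans)
    then show "x \<in> (\<Union> (range (\<lambda>n::nat. {..of_nat n *\<^sub>R (\<Sum>Basis :: 'a)})))" by auto
  qed
qed (use eq fin in auto)

text \<open>Radial laws enter only through their cdf: K p t^(p-1) is the derivative of K r^p. Both
  the law of a squared norm and the substitution s = r^2 are settled by computing such a
  power.\<close>

lemma measure_eq_power_density:
  fixes M :: "real measure"
  assumes sets: "sets M = sets borel" and "0 < p" "0 \<le> K"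
    and pos: "\<And>r. 0 < r \<Longrightarrow> emeasure M {..r} = ennreal (K * r powr p)"
    and neg: "\<And>r. r \<le> 0 \<Longrightarrow> emeasure M {..r} = 0"
  shows "M = density lborel (\<lambda>t. ennreal (K * p * t powr (p - 1)) * indicator {0<..} t)"
proof (rule measure_eqI_atMost)
  let ?f = "\<lambda>t. ennreal (K * p * t powr (p - 1)) * indicator {0<..} t"
  show "emeasure M {..r} = emeasure (density lborel ?f) {..r}" for r
  proof (cases "0 < r")
    case True
    have "((\<lambda>x. K * p * x powr (p - 1)) has_integral (K * p * (r powr (p - 1 + 1) / (p - 1 + 1)))) {0..r}"
      using \<open>0 < p\<close> True by (intro has_integral_mult_right has_integral_powr_from_0) auto
    then have *: "((\<lambda>x. K * p * x powr (p - 1)) has_integral (K * r powr p)) {0..r}"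
      using \<open>0 < p\<close> by simp
    have "emeasure (density lborel ?f) {..r} = (\<integral>\<^sup>+t. ?f t * indicator {..r} t \<partial>lborel)"
      by (simp add: emeasure_density)
    also have "\<dots> = (\<integral>\<^sup>+t. ennreal (K * p * t powr (p - 1) * indicator {0..r} t) \<partial>lborel)"
      using AE_lborel_singleton[of 0]
      by (intro nn_integral_cong_AE, eventually_elim) (auto split: split_indicator)
    also have "\<dots> = ennreal (K * r powr p)"
      using \<open>0 < p\<close> \<open>0 \<le> K\<close>
      using nn_integral_has_integral_lebesgue[OF _ *]
      by (simp add: mult.commute)
    finally show ?thesis using pos[OF True] by simp
  next
    case False
    then have "?f t * indicator {..r} t = 0" for t by (auto split: split_indicator)
    then show ?thesis using neg False by (simp add: emeasure_density del: mult_eq_0_iff)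
  qed
  show "emeasure M {..r} \<noteq> \<infinity>" for r
    using pos neg by (cases "0 < r") auto
qed (use sets in auto)

text \<open>The sublevel set of the squared norm is a ball of radius sqrt r, so the cdf is the unit
  ball volume times r^(n/2), where n is the number of coordinates. The stated constant is n/2 times
  that volume, by Gamma (n/2 + 1) = n/2 Gamma (n/2).\<close>

lemma distr_sum_squares_PiM:
  assumes "finite A" "A \<noteq> {}"
  shows "distr (PiM A (\<lambda>_. lborel)) borel (\<lambda>f. \<Sum>k\<in>A. (f k)\<^sup>2) =
    density lborel (\<lambda>t. ennreal (pi powr (real (card A) / 2) / Gamma (real (card A) / 2) *
      t powr (real (card A) / 2 - 1)) * indicator {0<..} t)" (is "?M = _")
proof -
  let ?n = "real (card A)"
  have n: "0 < ?n" using assms by (simp add: card_gt_0_iff)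
  have [measurable]: "(\<lambda>f. \<Sum>k\<in>A. (f k)\<^sup>2) \<in> borel_measurable (PiM A (\<lambda>_. lborel :: real measure))"
    by measurable
  have m: "emeasure ?M {..r} = ennreal (unit_ball_vol ?n * r powr (?n / 2))" if "0 < r" for r
  proof -
    have "emeasure ?M {..r} = emeasure (PiM A (\<lambda>_. lborel))
       ({f. sqrt (\<Sum>i\<in>A. (f i)\<^sup>2) \<le> sqrt r} \<inter> space (Pi\<^sub>M A (\<lambda>_. lborel)))"
      by (subst emeasure_distr) (auto intro!: arg_cong[where f = "emeasure _"])
    also have "\<dots> = ennreal (unit_ball_vol ?n * sqrt r ^ card A)"
      using that by (intro emeasure_cball_aux assms) auto
    also have "sqrt r ^ card A = r powr (?n / 2)"
      using that by (simp add: powr_half_sqrt[symmetric] powr_realpow[symmetric] powr_powr)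
    finally show ?thesis .
  qed
  have z: "emeasure ?M {..r} = 0" if "r \<le> 0" for r
  proof -
    have "emeasure ?M {..r} \<le> e" if "0 < e" for e :: real
    proof -
      \<comment> \<open>The ball of squared radius \<open>s\<close> has volume exactly
        \<open>e\<close>. Monotonicity transfers this bound to r \<le> 0, outside the range of the
        volume formula \<open>m\<close>.\<close>
      define s where "s = (e / unit_ball_vol ?n) powr (2 / ?n)"
      have s: "0 < s" using that less_imp_neq[OF unit_ball_vol_pos[of ?n]] by (simp add: s_def)
      have "emeasure ?M {..r} \<le> emeasure ?M {..s}"
        using s \<open>r \<le> 0\<close> by (intro emeasure_mono) auto
      also have "\<dots> = ennreal (unit_ball_vol ?n * s powr (?n / 2))" by (rule m[OF s])
      also have "unit_ball_vol ?n * s powr (?n / 2) = e"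
        using n that less_imp_neq[OF unit_ball_vol_pos[of ?n]] by (simp add: s_def powr_powr)
      finally show ?thesis .
    qed
    then have "emeasure ?M {..r} \<le> 0 + ennreal e" if "0 < e" for e
      unfolding add_0 using that by blast
    then have "emeasure ?M {..r} \<le> 0"
      by (rule ennreal_le_epsilon)
    then show ?thesis by simp
  qed
  have "?M = density lborel (\<lambda>t. ennreal (unit_ball_vol ?n * (?n / 2) * t powr (?n / 2 - 1)) * indicator {0<..} t)"
    using n m z by (intro measure_eq_power_density) auto
  moreover have "unit_ball_vol ?n * (?n / 2) = pi powr (?n / 2) / Gamma (?n / 2)"
    using n Gamma_plus1[of "?n / 2"] by (auto simp: unit_ball_vol_def field_simps nonpos_Ints_def)
  ultimately show ?thesis by simp
qed

text \<open>Polar coordinates. With all coordinates this normalizes the spherical law; with one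
  coordinate omitted it produces the marginal density.\<close>

lemma nn_integral_sum_squares_PiM:
  assumes "finite A" "A \<noteq> {}" and [measurable]: "h \<in> borel_measurable borel"
  shows "(\<integral>\<^sup>+f. h (\<Sum>k\<in>A. (f k)\<^sup>2) \<partial>PiM A (\<lambda>_. lborel)) =
    ennreal (pi powr (real (card A) / 2) / Gamma (real (card A) / 2)) *
      (\<integral>\<^sup>+t\<in>{0<..}. h t * ennreal (t powr (real (card A) / 2 - 1)) \<partial>lborel)"
proof -
  let ?n = "real (card A)"
  have n: "0 < ?n" using assms by (simp add: card_gt_0_iff)
  have "(\<integral>\<^sup>+f. h (\<Sum>k\<in>A. (f k)\<^sup>2) \<partial>PiM A (\<lambda>_. lborel)) =
     (\<integral>\<^sup>+t. h t \<partial>distr (PiM A (\<lambda>_. lborel)) borel (\<lambda>f. \<Sum>k\<in>A. (f k)\<^sup>2))"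
    by (subst nn_integral_distr) auto
  also have "\<dots> = (\<integral>\<^sup>+t. ennreal (pi powr (?n / 2) / Gamma (?n / 2)) *
      (h t * ennreal (t powr (?n / 2 - 1)) * indicator {0<..} t) \<partial>lborel)"
    unfolding distr_sum_squares_PiM[OF assms(1,2)] using n
    by (subst nn_integral_density)
      (auto simp: ennreal_mult'[symmetric] mult_ac intro!: nn_integral_cong split: split_indicator)
  also have "\<dots> = ennreal (pi powr (?n / 2) / Gamma (?n / 2)) *
      (\<integral>\<^sup>+t\<in>{0<..}. h t * ennreal (t powr (?n / 2 - 1)) \<partial>lborel)"
    by (subst nn_integral_cmult) auto
  finally show ?thesis .
qed

text \<open>With s = r^2 one has s^(m/2 - 1) ds = 2 r^(m-1) dr. For m = d - 1 this links
  \<open>marginal_density\<close>, an integral in s, to the integral in r whose differentiability is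
  part of regularity.\<close>

lemma nn_integral_powr_substitution_square:
  assumes [measurable]: "h \<in> borel_measurable borel" and "m \<ge> 1"
  shows "(\<integral>\<^sup>+s\<in>{0<..}. h s * ennreal (s powr (real m / 2 - 1)) \<partial>lborel) =
    2 * (\<integral>\<^sup>+r\<in>{0<..}. h (r\<^sup>2) * ennreal (r ^ (m - 1)) \<partial>lborel)"
proof -
  let ?D = "density lborel (\<lambda>r. ennreal (2 * r ^ (m - 1)) * indicator {0<..} r)"
  let ?M = "distr ?D borel (\<lambda>r. r\<^sup>2)"
  have pw: "r ^ (m - 1) = r powr (real m - 1)" if "0 < r" for r :: real
    using that \<open>m \<ge> 1\<close> by (simp add: powr_realpow[symmetric] of_nat_diff)
  have "?M = density lborel (\<lambda>t. ennreal (2 / real m * (real m / 2) * t powr (real m / 2 - 1)) * indicator {0<..} t)"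
  proof (rule measure_eq_power_density)
    fix r :: real
    assume r: "0 < r"
    have "((\<lambda>x. 2 * x powr (real m - 1)) has_integral (2 * (sqrt r powr (real m - 1 + 1) / (real m - 1 + 1)))) {0..sqrt r}"
      using \<open>m \<ge> 1\<close> r by (intro has_integral_mult_right has_integral_powr_from_0) auto
    then have *: "((\<lambda>x. 2 * x powr (real m - 1)) has_integral (2 / real m * r powr (real m / 2))) {0..sqrt r}"
      using r by (simp add: powr_half_sqrt[symmetric] powr_powr)
    have le: "x\<^sup>2 \<le> r \<longleftrightarrow> x \<le> sqrt r" if "0 < x" for x
      using that r real_sqrt_le_iff[of "x\<^sup>2" r] by simp
    have "emeasure ?M {..r} = (\<integral>\<^sup>+x. ennreal (2 * x ^ (m - 1)) * indicator {0<..} x * indicator {x. x\<^sup>2 \<le> r} x \<partial>lborel)"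
      by (subst emeasure_distr) (auto simp: emeasure_density vimage_def)
    also have "\<dots> = (\<integral>\<^sup>+x. ennreal (2 * x powr (real m - 1) * indicator {0..sqrt r} x) \<partial>lborel)"
      using AE_lborel_singleton[of 0]
      by (intro nn_integral_cong_AE, eventually_elim)
        (auto split: split_indicator simp: pw[unfolded One_nat_def] le)
    also have "\<dots> = ennreal (2 / real m * r powr (real m / 2))"
      using nn_integral_has_integral_lebesgue[OF _ *] by (simp add: mult.commute)
    finally show "emeasure ?M {..r} = ennreal (2 / real m * r powr (real m / 2))" .
  next
    fix r :: real
    assume r: "r \<le> 0"
    have "emeasure ?M {..r} = (\<integral>\<^sup>+x. ennreal (2 * x ^ (m - 1)) * indicator {0<..} x * indicator {x. x\<^sup>2 \<le> r} x \<partial>lborel)"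
      by (subst emeasure_distr) (auto simp: emeasure_density vimage_def)
    also have "\<dots> = (\<integral>\<^sup>+x. 0 \<partial>(lborel :: real measure))"
    proof (intro nn_integral_cong)
      fix x :: real
      have "\<not> x\<^sup>2 \<le> r" if "0 < x" using that r zero_less_power[OF that, of 2] by linarith
      then show "ennreal (2 * x ^ (m - 1)) * indicator {0<..} x * indicator {x. x\<^sup>2 \<le> r} x = 0"
        by (auto split: split_indicator)
    qed
    finally show "emeasure ?M {..r} = 0" by simp
  qed (use \<open>m \<ge> 1\<close> in auto)
  then have M: "?M = density lborel (\<lambda>t. ennreal (t powr (real m / 2 - 1)) * indicator {0<..} t)"
    using \<open>m \<ge> 1\<close> by simp
  have "(\<integral>\<^sup>+s\<in>{0<..}. h s * ennreal (s powr (real m / 2 - 1)) \<partial>lborel) = (\<integral>\<^sup>+s. h s \<partial>?M)"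
    unfolding M by (subst nn_integral_density) (auto simp: mult_ac intro!: nn_integral_cong)
  also have "\<dots> = (\<integral>\<^sup>+r. h (r\<^sup>2) \<partial>?D)" by (subst nn_integral_distr) auto
  also have "\<dots> = (\<integral>\<^sup>+r. 2 * (h (r\<^sup>2) * ennreal (r ^ (m - 1)) * indicator {0<..} r) \<partial>lborel)"
  proof -
    have eq: "ennreal (2 * r ^ (m - 1)) = 2 * ennreal (r ^ (m - 1))" for r :: real
      by (simp add: ennreal_mult')
    show ?thesis
      apply (subst nn_integral_density)
        apply measurable
      apply (rule nn_integral_cong)
      apply (subst eq)
      apply (simp only: mult_ac)
      done
  qed
  also have "\<dots> = 2 * (\<integral>\<^sup>+r\<in>{0<..}. h (r\<^sup>2) * ennreal (r ^ (m - 1)) \<partial>lborel)"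
    by (subst nn_integral_cmult) auto
  finally show ?thesis .
qed

section \<open>Linear maps and Lebesgue measure\<close>

lemma prod_Basis_cart:
  fixes f :: "real^'n \<Rightarrow> 'a::comm_monoid_mult"
  shows "prod f Basis = (\<Prod>k\<in>UNIV. f (axis k 1))"
  by (simp add: Basis_vec_def UNION_singleton_eq_range prod.reindex axis_eq_axis inj_on_def)

lemma sum_Basis_cart:
  fixes f :: "real^'n \<Rightarrow> 'a::comm_monoid_add"
  shows "sum f Basis = (\<Sum>k\<in>UNIV. f (axis k 1))"
  by (simp add: Basis_vec_def UNION_singleton_eq_range sum.reindex axis_eq_axis inj_on_def)

lemma borel_measurable_vec_lambda:
  fixes f :: "'a \<Rightarrow> 'n::finite \<Rightarrow> real"
  assumes "\<And>k. (\<lambda>x. f x k) \<in> borel_measurable M"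
  shows "(\<lambda>x. \<chi> k. f x k) \<in> borel_measurable M"
  unfolding borel_measurable_euclidean_space[where f = "\<lambda>x. \<chi> k. f x k"]
  using assms by (auto simp: Basis_vec_def inner_axis)

lemma borel_measurable_vec_nth [measurable]:
  "(\<lambda>x :: real^'n. x $ k) \<in> borel_measurable borel"
  by (intro borel_measurable_continuous_onI continuous_intros)

lemma lborel_cart_eqI:
  fixes M :: "(real^'n) measure"
  assumes "\<And>l u. (\<And>k. l $ k \<le> u $ k) \<Longrightarrow> emeasure M (box l u) = (\<Prod>k\<in>UNIV. u $ k - l $ k)"
    and "sets M = sets borel"
  shows "lborel = M"
proof (rule lborel_eqI)
  fix l u :: "real^'n"
  assume le: "\<And>b. b \<in> Basis \<Longrightarrow> l \<bullet> b \<le> u \<bullet> b"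
  have "l $ k \<le> u $ k" for k
    using le[of "axis k 1"] by (auto simp: inner_axis Basis_vec_def)
  then show "emeasure M (box l u) = (\<Prod>b\<in>Basis. (u - l) \<bullet> b)"
    using assms(1)[of l u] by (simp add: prod_Basis_cart inner_axis)
qed (rule assms)

lemma lborel_eq_PiM_cart:
  "(lborel :: (real^'n) measure) = distr (PiM UNIV (\<lambda>_. lborel)) borel (\<lambda>f. \<chi> k. f k)"
proof (rule lborel_cart_eqI)
  interpret product_sigma_finite "\<lambda>_::'n. lborel :: real measure" by standard
  fix l u :: "real^'n"
  assume le: "\<And>k. l $ k \<le> u $ k"
  have "emeasure (distr (PiM UNIV (\<lambda>_. lborel)) borel (\<lambda>f. \<chi> k. f k)) (box l u) =
      emeasure (PiM UNIV (\<lambda>_. lborel)) (\<Pi>\<^sub>E k\<in>UNIV. {l $ k <..< u $ k})"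
    by (subst emeasure_distr)
      (auto simp: space_PiM mem_box_cart PiE_iff intro!: arg_cong[where f = "emeasure _"] borel_measurable_vec_lambda)
  also have "\<dots> = (\<Prod>k\<in>UNIV. u $ k - l $ k)"
    by (subst emeasure_PiM) (auto simp: le prod_ennreal)
  finally show "emeasure (distr (PiM UNIV (\<lambda>_. lborel)) borel (\<lambda>f. \<chi> k. f k)) (box l u) =
      (\<Prod>k\<in>UNIV. u $ k - l $ k)" .
qed simp

lemma nn_integral_lborel_cart:
  fixes f :: "real^'n \<Rightarrow> ennreal"
  assumes [measurable]: "f \<in> borel_measurable borel"
  shows "(\<integral>\<^sup>+x. f x \<partial>lborel) = (\<integral>\<^sup>+y. f (\<chi> k. y k) \<partial>PiM UNIV (\<lambda>_. lborel))"
  by (subst lborel_eq_PiM_cart, subst nn_integral_distr) (auto intro!: borel_measurable_vec_lambda)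

text \<open>The first order of integration serves shears, which translate one coordinate while the
  others are fixed. The second serves margins, where the other coordinates are integrated out
  first.\<close>

lemma nn_integral_lborel_cart_insert:
  fixes f :: "real^'n \<Rightarrow> ennreal"
  assumes [measurable]: "f \<in> borel_measurable borel"
  shows "(\<integral>\<^sup>+x. f x \<partial>lborel) =
      (\<integral>\<^sup>+y. \<integral>\<^sup>+t. f (\<chi> l. if l = k then t else y l) \<partial>lborel \<partial>PiM (UNIV - {k}) (\<lambda>_. lborel))" (is ?th1)
    and "(\<integral>\<^sup>+x. f x \<partial>lborel) =
      (\<integral>\<^sup>+t. \<integral>\<^sup>+y. f (\<chi> l. if l = k then t else y l) \<partial>PiM (UNIV - {k}) (\<lambda>_. lborel) \<partial>lborel)" (is ?th2)
proof -
  interpret product_sigma_finite "\<lambda>_::'n. lborel :: real measure" by standard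
  have ins: "UNIV = insert k (UNIV - {k})" by auto
  have m: "(\<lambda>y. f (\<chi> k. y k)) \<in> borel_measurable (PiM (insert k (UNIV - {k})) (\<lambda>_. lborel))"
    using ins by (intro measurable_compose[OF borel_measurable_vec_lambda assms]) auto
  have eq: "(\<chi> l. (y(k := t)) l) = (\<chi> l. if l = k then t else y l)" for y :: "'n \<Rightarrow> real" and t
    by (auto simp: vec_eq_iff)
  have "(\<integral>\<^sup>+x. f x \<partial>lborel) = (\<integral>\<^sup>+y. f (\<chi> k. y k) \<partial>PiM (insert k (UNIV - {k})) (\<lambda>_. lborel))"
    using ins by (simp add: nn_integral_lborel_cart)
  then show ?th1 ?th2
    using product_nn_integral_insert[OF _ _ m] product_nn_integral_insert_rev[OF _ _ m]
    by (simp_all add: eq)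
qed

text \<open>\<open>measure_linear_image\<close> needs a well-ordered index type, hence the proof by elementary maps.\<close>

lemma distr_lborel_linear:
  fixes f :: "real^'n \<Rightarrow> real^'n"
  assumes "linear f" "det (matrix f) \<noteq> 0"
  shows "distr lborel borel f = density lborel (\<lambda>_. ennreal (1 / \<bar>det (matrix f)\<bar>))"
proof -
  have meas: "h \<in> borel_measurable borel" if "linear h" for h :: "real^'n \<Rightarrow> real^'n"
    using that by (intro borel_measurable_continuous_onI linear_continuous_on)
      (simp add: linear_conv_bounded_linear)
  have "det (matrix f) \<noteq> 0 \<longrightarrow> distr lborel borel f = density lborel (\<lambda>_. ennreal (1 / \<bar>det (matrix f)\<bar>))"
  proof (rule induct_linear_elementary[OF \<open>linear f\<close>, where P = "\<lambda>f. det (matrix f) \<noteq> 0 \<longrightarrow>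
      distr lborel borel f = density lborel (\<lambda>_. ennreal (1 / \<bar>det (matrix f)\<bar>))"])
    fix f h :: "real^'n \<Rightarrow> real^'n"
    assume lin[simp]: "linear f" "linear h"
      and f: "det (matrix f) \<noteq> 0 \<longrightarrow> distr lborel borel f = density lborel (\<lambda>_. ennreal (1 / \<bar>det (matrix f)\<bar>))"
      and h: "det (matrix h) \<noteq> 0 \<longrightarrow> distr lborel borel h = density lborel (\<lambda>_. ennreal (1 / \<bar>det (matrix h)\<bar>))"
    have D: "det (matrix (f \<circ> h)) = det (matrix f) * det (matrix h)"
      by (simp add: matrix_compose det_mul)
    show "det (matrix (f \<circ> h)) \<noteq> 0 \<longrightarrow>
      distr lborel borel (f \<circ> h) = density lborel (\<lambda>_. ennreal (1 / \<bar>det (matrix (f \<circ> h))\<bar>))"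
    proof
      assume "det (matrix (f \<circ> h)) \<noteq> 0"
      then have nz: "det (matrix f) \<noteq> 0" "det (matrix h) \<noteq> 0" by (auto simp: D)
      have "distr lborel borel (f \<circ> h) = distr (distr lborel borel h) borel f"
        by (subst distr_distr) (auto simp: meas)
      also have "\<dots> = distr (density lborel (\<lambda>_. ennreal (1 / \<bar>det (matrix h)\<bar>))) borel f"
        using h nz by simp
      also have "\<dots> = density (distr lborel borel f) (\<lambda>_. ennreal (1 / \<bar>det (matrix h)\<bar>))"
        by (subst density_distr) (auto simp: meas)
      also have "\<dots> = density (density lborel (\<lambda>_. ennreal (1 / \<bar>det (matrix f)\<bar>))) (\<lambda>_. ennreal (1 / \<bar>det (matrix h)\<bar>))"
        using f nz by simp
      also have "\<dots> = density lborel (\<lambda>_. ennreal (1 / \<bar>det (matrix (f \<circ> h))\<bar>))"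
        by (subst density_density_eq) (auto simp: D ennreal_mult[symmetric] abs_mult)
      finally show "distr lborel borel (f \<circ> h) = density lborel (\<lambda>_. ennreal (1 / \<bar>det (matrix (f \<circ> h))\<bar>))" .
    qed
  next
    fix f :: "real^'n \<Rightarrow> real^'n" and i
    assume "linear f" "\<And>x. f x $ i = 0"
    then have "row i (matrix f) = 0"
      by (auto simp: row_def matrix_def vec_eq_iff)
    then show "det (matrix f) \<noteq> 0 \<longrightarrow> distr lborel borel f = density lborel (\<lambda>_. ennreal (1 / \<bar>det (matrix f)\<bar>))"
      using det_zero_row(1) by blast
  next
    fix c :: "'n \<Rightarrow> real"
    let ?f = "\<lambda>x :: real^'n. \<chi> i. c i * x $ i"
    have D: "det (matrix ?f) = prod c UNIV"
      by (subst det_diagonal) (auto simp: matrix_def axis_def)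
    show "det (matrix ?f) \<noteq> 0 \<longrightarrow> distr lborel borel ?f = density lborel (\<lambda>_. ennreal (1 / \<bar>det (matrix ?f)\<bar>))"
    proof
      assume "det (matrix ?f) \<noteq> 0"
      then have c: "c k \<noteq> 0" for k unfolding D by auto
      \<comment> \<open>\<open>lborel_affine_euclidean\<close> scales along basis vectors; the
        choice operator recovers the index \<open>k\<close> from \<open>axis k 1\<close>,
        unambiguously by \<open>axis_eq_axis\<close>.\<close>
      have T: "0 + (\<Sum>j\<in>Basis. (c (SOME k. j = axis k 1) * (x \<bullet> j)) *\<^sub>R j) = ?f x" for x :: "real^'n"
        by (simp add: sum_Basis_cart axis_eq_axis inner_axis)
          (simp add: vec_eq_iff axis_def if_distrib cong: if_cong)
      have "lborel = density (distr lborel borel ?f) (\<lambda>_. (\<Prod>j\<in>Basis. \<bar>c (SOME k. (j::real^'n) = axis k 1)\<bar>))"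
        using lborel_affine_euclidean[of "\<lambda>j. c (SOME k. j = axis k 1)" "0 :: real^'n"] c unfolding T by simp
      also have "(\<Prod>j\<in>Basis. \<bar>c (SOME k. (j::real^'n) = axis k 1)\<bar>) = \<bar>det (matrix ?f)\<bar>"
        by (simp add: prod_Basis_cart axis_eq_axis D abs_prod)
      finally have "density lborel (\<lambda>_. ennreal (1 / \<bar>det (matrix ?f)\<bar>)) =
          density (density (distr lborel borel ?f) (\<lambda>_. \<bar>det (matrix ?f)\<bar>)) (\<lambda>_. ennreal (1 / \<bar>det (matrix ?f)\<bar>))"
        by simp
      also have "\<dots> = distr lborel borel ?f"
        using \<open>det (matrix ?f) \<noteq> 0\<close>
        by (subst density_density_eq) (auto simp: ennreal_mult'[symmetric] density_1)
      finally show "distr lborel borel ?f = density lborel (\<lambda>_. ennreal (1 / \<bar>det (matrix ?f)\<bar>))" ..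
    qed
  next
    fix m n :: 'n
    assume "m \<noteq> n"
    let ?p = "Transposition.transpose m n"
    let ?f = "\<lambda>x :: real^'n. \<chi> i. x $ ?p i"
    have lin: "linear ?f" by (auto intro!: linearI simp: vec_eq_iff)
    have "orthogonal_transformation ?f"
      unfolding orthogonal_transformation_def
    proof (intro conjI lin allI)
      fix x y :: "real^'n"
      show "?f x \<bullet> ?f y = x \<bullet> y" unfolding inner_vec_def
        by (rule sum.reindex_bij_witness[where i = ?p and j = ?p]) auto
    qed
    then have D: "\<bar>det (matrix ?f)\<bar> = 1"
      by (rule orthogonal_transformation_det)
    have "lborel = distr lborel borel ?f"
    proof (rule lborel_cart_eqI)
      fix l u :: "real^'n"
      assume le: "\<And>k. l $ k \<le> u $ k"
      have "?f -` box l u = box (?f l) (?f u)"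
        by (auto simp: mem_box_cart) (metis transpose_involutory)+
      then have "emeasure (distr lborel borel ?f) (box l u) = emeasure lborel (box (?f l) (?f u))"
        using meas[OF lin] by (subst emeasure_distr) auto
      also have "\<dots> = (\<Prod>k\<in>UNIV. u $ ?p k - l $ ?p k)"
      proof (subst emeasure_lborel_box)
        show "?f l \<bullet> b \<le> ?f u \<bullet> b" if "b \<in> Basis" for b
          using that le by (auto simp: inner_axis Basis_vec_def)
      qed (simp add: prod_Basis_cart inner_axis)
      also have "(\<Prod>k\<in>UNIV. u $ ?p k - l $ ?p k) = (\<Prod>k\<in>UNIV. u $ k - l $ k)"
        by (rule prod.reindex_bij_witness[where i = ?p and j = ?p]) auto
      finally show "emeasure (distr lborel borel ?f) (box l u) = (\<Prod>k\<in>UNIV. u $ k - l $ k)" .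
    qed simp
    then show "det (matrix ?f) \<noteq> 0 \<longrightarrow> distr lborel borel ?f = density lborel (\<lambda>_. ennreal (1 / \<bar>det (matrix ?f)\<bar>))"
      by (simp add: D density_1)
  next
    fix m n :: 'n
    assume mn: "m \<noteq> n"
    let ?f = "\<lambda>x :: real^'n. \<chi> i. if i = m then x $ m + x $ n else x $ i"
    have lin: "linear ?f" by (auto intro!: linearI simp: vec_eq_iff algebra_simps)
    have "matrix ?f = (\<chi> k. if k = m then row m (mat 1) + 1 *s row n (mat 1) else row k (mat 1))"
      by (auto simp: vec_eq_iff matrix_def row_def mat_def axis_def)
    then have D: "det (matrix ?f) = 1"
      using det_row_operation[OF mn, where A = "mat 1 :: real^'n^'n" and c = 1] by simp
    have "lborel = distr lborel borel ?f"
    proof (rule measure_eqI)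
      fix S :: "(real^'n) set"
      assume "S \<in> sets lborel"
      then have [measurable]: "S \<in> sets borel" by simp
      have "emeasure (distr lborel borel ?f) S = (\<integral>\<^sup>+x. indicator S (?f x) \<partial>lborel)"
        using meas[OF lin] by (subst nn_integral_indicator[symmetric], simp, subst nn_integral_distr) auto
      also have "\<dots> = (\<integral>\<^sup>+y. \<integral>\<^sup>+t. indicator S (\<chi> l. if l = m then t + y n else y l) \<partial>lborel \<partial>PiM (UNIV - {m}) (\<lambda>_. lborel))"
        using mn measurable_compose[OF meas[OF lin] borel_measurable_indicator[of S]]
        by (subst nn_integral_lborel_cart_insert(1)[where k = m])
          (auto intro!: nn_integral_cong arg_cong[where f = "indicator S"] simp: vec_eq_iff)
      \<comment> \<open>With the other coordinates fixed, the shear translates coordinate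
        \<open>m\<close> by the constant \<open>y n\<close>, and one-dimensional Lebesgue measure is
        translation invariant.\<close>
      also have "\<dots> = (\<integral>\<^sup>+y. \<integral>\<^sup>+t. indicator S (\<chi> l. if l = m then t else y l) \<partial>lborel \<partial>PiM (UNIV - {m}) (\<lambda>_. lborel))"
      proof (rule nn_integral_cong)
        fix y :: "'n \<Rightarrow> real"
        let ?h = "\<lambda>t. indicator S (\<chi> l. if l = m then t else y l) :: ennreal"
        have [measurable]: "(\<lambda>t. \<chi> l. if l = m then t else y l) \<in> borel_measurable (borel :: real measure)"
          by (intro borel_measurable_vec_lambda) auto
        show "(\<integral>\<^sup>+t. ?h (t + y n) \<partial>lborel) = (\<integral>\<^sup>+t. ?h t \<partial>lborel)"
          using nn_integral_real_affine[of ?h 1 "y n"] by (simp add: add.commute cong del: if_weak_cong)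
      qed
      also have "\<dots> = (\<integral>\<^sup>+x. indicator S x \<partial>lborel)"
        by (subst nn_integral_lborel_cart_insert(1)[where k = m]) auto
      finally show "emeasure lborel S = emeasure (distr lborel borel ?f) S" by simp
    qed simp
    then show "det (matrix ?f) \<noteq> 0 \<longrightarrow> distr lborel borel ?f = density lborel (\<lambda>_. ennreal (1 / \<bar>det (matrix ?f)\<bar>))"
      by (simp add: D density_1)
  qed
  with assms show ?thesis by simp
qed

section \<open>Spherical and elliptical laws\<close>

lemma borel_measurable_generator_comp:
  fixes g :: "real \<Rightarrow> ennreal"
  assumes "g \<in> borel_measurable (restrict_space borel {0..})"
    and "f \<in> borel_measurable N" "\<And>x. x \<in> space N \<Longrightarrow> 0 \<le> f x"
  shows "(\<lambda>x. g (f x)) \<in> borel_measurable N"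
  using assms by (intro measurable_compose[OF _ assms(1)] measurable_restrict_space2) auto

text \<open>A generator is measurable only on the half line. Composing with the absolute value gives
  a Borel function on the whole line without changing any value that matters.\<close>

lemma borel_measurable_generator_abs:
  fixes g :: "real \<Rightarrow> ennreal"
  assumes "g \<in> borel_measurable (restrict_space borel {0..})"
  shows "(\<lambda>t. g \<bar>t\<bar>) \<in> borel_measurable borel"
  by (rule borel_measurable_generator_comp[OF assms]) auto

lemma matrix_inv_mat_1: "matrix_inv (mat 1 :: real^'n^'n) = mat 1"
  using someI_ex[of "\<lambda>A'. mat 1 ** A' = (mat 1 :: real^'n^'n) \<and> A' ** mat 1 = (mat 1 :: real^'n^'n)"]
  unfolding matrix_inv_def by auto

lemma elliptical_mat_1:
  "elliptical 0 (mat 1 :: real^'n^'n) g = density lborel (\<lambda>x. g (x \<bullet> x))"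
  by (simp add: elliptical_def matrix_inv_mat_1)

lemma nn_integral_spherical:
  fixes g :: "real \<Rightarrow> ennreal"
  assumes g: "g \<in> borel_measurable (restrict_space borel {0..})"
  shows "(\<integral>\<^sup>+x. g ((x :: real^'n) \<bullet> x) \<partial>lborel) = ennreal (sphere_area CARD('n) / 2) *
    (\<integral>\<^sup>+t\<in>{0<..}. ennreal (t powr (real CARD('n) / 2 - 1)) * g t \<partial>lborel)"
proof -
  note [measurable] = borel_measurable_generator_abs[OF g] borel_measurable_generator_comp[OF g]
  have "(\<integral>\<^sup>+x. g ((x :: real^'n) \<bullet> x) \<partial>lborel) =
      (\<integral>\<^sup>+y. g \<bar>\<Sum>k\<in>UNIV. (y k)\<^sup>2\<bar> \<partial>PiM (UNIV :: 'n set) (\<lambda>_. lborel))"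
    by (subst nn_integral_lborel_cart) (auto simp: inner_vec_def power2_eq_square sum_nonneg)
  also have "\<dots> = ennreal (sphere_area CARD('n) / 2) *
    (\<integral>\<^sup>+t\<in>{0<..}. g \<bar>t\<bar> * ennreal (t powr (real CARD('n) / 2 - 1)) \<partial>lborel)"
    by (subst nn_integral_sum_squares_PiM[where h = "\<lambda>t. g \<bar>t\<bar>"]) (auto simp: sphere_area_def)
  also have "(\<integral>\<^sup>+t\<in>{0<..}. g \<bar>t\<bar> * ennreal (t powr (real CARD('n) / 2 - 1)) \<partial>lborel) =
    (\<integral>\<^sup>+t\<in>{0<..}. ennreal (t powr (real CARD('n) / 2 - 1)) * g t \<partial>lborel)"
    by (intro nn_integral_cong) (auto split: split_indicator simp: mult.commute)
  finally show ?thesis .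
qed

lemma prob_space_spherical:
  assumes "density_generator CARD('n) g"
  shows "prob_space (elliptical 0 (mat 1 :: real^'n^'n) g)"
proof
  have g: "g \<in> borel_measurable (restrict_space borel {0..})"
    using assms by (simp add: density_generator_def)
  note [measurable] = borel_measurable_generator_comp[OF g]
  show "emeasure (elliptical 0 (mat 1 :: real^'n^'n) g) (space (elliptical 0 (mat 1 :: real^'n^'n) g)) = 1"
    using assms nn_integral_spherical[OF g, where 'n = 'n]
    by (simp add: elliptical_mat_1 emeasure_density density_generator_def)
qed

text \<open>Fixing coordinate \<open>k\<close> at \<open>t\<close> leaves a radial integral over d -
  1 coordinates, and (d-1)/2 - 1 is the exponent (d-3)/2 of the marginal density.\<close>

lemma marginal_density_eq_PiM:
  fixes g :: "real \<Rightarrow> ennreal" and k :: "'n::finite"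
  assumes g: "g \<in> borel_measurable (restrict_space borel {0..})" and "2 \<le> CARD('n)"
  shows "marginal_density CARD('n) g t =
    (\<integral>\<^sup>+y. g (t\<^sup>2 + (\<Sum>l\<in>UNIV - {k}. (y l)\<^sup>2)) \<partial>PiM (UNIV - {k}) (\<lambda>_. lborel))"
proof -
  note [measurable] = borel_measurable_generator_abs[OF g]
  have card: "card (UNIV - {k}) = CARD('n) - 1" by simp
  have ne: "UNIV - {k} \<noteq> {}"
    using arg_cong[of "UNIV - {k}" "{}" card] card \<open>2 \<le> CARD('n)\<close> by auto
  have "(\<integral>\<^sup>+y. g (t\<^sup>2 + (\<Sum>l\<in>UNIV - {k}. (y l)\<^sup>2)) \<partial>PiM (UNIV - {k}) (\<lambda>_. lborel)) =
      (\<integral>\<^sup>+y. g \<bar>t\<^sup>2 + (\<Sum>l\<in>UNIV - {k}. (y l)\<^sup>2)\<bar> \<partial>PiM (UNIV - {k}) (\<lambda>_. lborel))"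
    by (simp add: sum_nonneg)
  also have "\<dots> = ennreal (pi powr ((real CARD('n) - 1) / 2) / Gamma ((real CARD('n) - 1) / 2)) *
      (\<integral>\<^sup>+s\<in>{0<..}. g \<bar>t\<^sup>2 + s\<bar> * ennreal (s powr ((real CARD('n) - 1) / 2 - 1)) \<partial>lborel)"
    using ne \<open>2 \<le> CARD('n)\<close>
    by (subst nn_integral_sum_squares_PiM[where h = "\<lambda>s. g \<bar>t\<^sup>2 + s\<bar>"]) (auto simp: card of_nat_diff)
  also have "(\<integral>\<^sup>+s\<in>{0<..}. g \<bar>t\<^sup>2 + s\<bar> * ennreal (s powr ((real CARD('n) - 1) / 2 - 1)) \<partial>lborel) =
      (\<integral>\<^sup>+s\<in>{0<..}. g (t\<^sup>2 + s) * ennreal (s powr ((real CARD('n) - 3) / 2)) \<partial>lborel)"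
  proof (intro nn_integral_cong)
    fix s :: real
    have eq: "(real CARD('n) - 1) / 2 - 1 = (real CARD('n) - 3) / 2" by (simp add: field_simps)
    show "g \<bar>t\<^sup>2 + s\<bar> * ennreal (s powr ((real CARD('n) - 1) / 2 - 1)) * indicator {0<..} s =
      g (t\<^sup>2 + s) * ennreal (s powr ((real CARD('n) - 3) / 2)) * indicator {0<..} s"
      unfolding eq by (auto split: split_indicator)
  qed
  finally show ?thesis by (simp add: marginal_density_def)
qed

lemma borel_measurable_marginal_density [measurable]:
  fixes g :: "real \<Rightarrow> ennreal"
  assumes g: "g \<in> borel_measurable (restrict_space borel {0..})"
  shows "marginal_density d g \<in> borel_measurable borel"
proof -
  note [measurable] = borel_measurable_generator_abs[OF g]
  have "marginal_density d g = (\<lambda>t. ennreal (pi powr ((real d - 1) / 2) / Gamma ((real d - 1) / 2)) *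
       (\<integral>\<^sup>+s. g \<bar>t\<^sup>2 + s\<bar> * ennreal (s powr ((real d - 3) / 2)) * indicator {0<..} s \<partial>lborel))"
    unfolding marginal_density_def fun_eq_iff
  proof (rule allI, rule arg_cong2[where f = "(*)"], rule refl, rule nn_integral_cong)
    fix t s :: real
    show "g (t\<^sup>2 + s) * ennreal (s powr ((real d - 3) / 2)) * indicator {0<..} s =
        g \<bar>t\<^sup>2 + s\<bar> * ennreal (s powr ((real d - 3) / 2)) * indicator {0<..} s"
      by (auto split: split_indicator)
  qed
  then show ?thesis by simp
qed

lemma margin_spherical:
  fixes g :: "real \<Rightarrow> ennreal" and k :: "'n::finite"
  assumes g: "g \<in> borel_measurable (restrict_space borel {0..})" and "2 \<le> CARD('n)"
  shows "margin (elliptical 0 (mat 1 :: real^'n^'n) g) k = density lborel (marginal_density CARD('n) g)"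
proof (rule measure_eqI)
  note [measurable] = borel_measurable_generator_comp[OF g] borel_measurable_generator_abs[OF g]
    borel_measurable_marginal_density[OF g]
  fix S assume "S \<in> sets (margin (elliptical 0 (mat 1 :: real^'n^'n) g) k)"
  then have S [measurable]: "S \<in> sets borel" by (simp add: margin_def)
  have sum: "(\<Sum>l\<in>UNIV. (if l = k then t else y l)\<^sup>2) = t\<^sup>2 + (\<Sum>l\<in>UNIV - {k}. (y l)\<^sup>2)" for t and y :: "'n \<Rightarrow> real"
    by (subst sum.remove[of _ k]) auto
  have "emeasure (margin (elliptical 0 (mat 1 :: real^'n^'n) g) k) S =
      (\<integral>\<^sup>+x. g ((x :: real^'n) \<bullet> x) * indicator S (x $ k) \<partial>lborel)"
  proof -
    have "(\<lambda>x :: real^'n. x $ k) -` S \<in> sets borel"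
      using measurable_sets_borel[OF borel_measurable_vec_nth S] .
    then show ?thesis
      by (auto simp: margin_def elliptical_mat_1 emeasure_distr emeasure_density
          intro!: nn_integral_cong split: split_indicator)
  qed
  also have "\<dots> = (\<integral>\<^sup>+t. \<integral>\<^sup>+y. g \<bar>t\<^sup>2 + (\<Sum>l\<in>UNIV - {k}. (y l)\<^sup>2)\<bar> * indicator S t
      \<partial>PiM (UNIV - {k}) (\<lambda>_. lborel) \<partial>lborel)"
    by (subst nn_integral_lborel_cart_insert(2)[where k = k])
      (auto simp: inner_vec_def power2_eq_square[symmetric] sum sum_nonneg)
  also have "\<dots> = (\<integral>\<^sup>+t. marginal_density CARD('n) g t * indicator S t \<partial>lborel)"
    by (intro nn_integral_cong, subst nn_integral_multc)
      (auto simp: marginal_density_eq_PiM[OF g \<open>2 \<le> CARD('n)\<close>, of _ k] sum_nonneg)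
  finally show "emeasure (margin (elliptical 0 (mat 1 :: real^'n^'n) g) k) S =
      emeasure (density lborel (marginal_density CARD('n) g)) S"
    by (simp add: emeasure_density)
qed (simp add: margin_def)

text \<open>Gram-Schmidt completion for the inner product given by \<open>A\<close>. Indexing the
  vectors by coordinates lets prescribed vectors keep their positions as columns of a square
  matrix.\<close>

lemma extend_orthonormal:
  fixes A :: "real^'n^'n" and v :: "'n \<Rightarrow> real^'n"
  assumes sym: "\<And>x y. x \<bullet> (A *v y) = y \<bullet> (A *v x)" and pos: "\<And>x. x \<noteq> 0 \<Longrightarrow> 0 < x \<bullet> (A *v x)"
    and orth: "\<And>k l. k \<in> S \<Longrightarrow> l \<in> S \<Longrightarrow> v k \<bullet> (A *v v l) = of_bool (k = l)"
  obtains w where "\<And>k. k \<in> S \<Longrightarrow> w k = v k" "\<And>k l. w k \<bullet> (A *v w l) = of_bool (k = l)"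
proof -
  have "\<exists>w. (\<forall>k\<in>S. w k = v k) \<and> (\<forall>k\<in>S \<union> T. \<forall>l\<in>S \<union> T. w k \<bullet> (A *v w l) = of_bool (k = l))"
    if "finite T" "S \<inter> T = {}" for T
    using that
  proof (induction T)
    case empty
    then show ?case using orth by (intro exI[of _ v]) auto
  next
    case (insert t T)
    then obtain w where w: "\<forall>k\<in>S. w k = v k" "\<forall>k\<in>S \<union> T. \<forall>l\<in>S \<union> T. w k \<bullet> (A *v w l) = of_bool (k = l)"
      by auto
    let ?E = "span ((\<lambda>k. A *v w k) ` (S \<union> T))"
    have "t \<notin> S \<union> T" using insert by auto
    then have "card (S \<union> T) < CARD('n)" by (intro psubset_card_mono) auto
    moreover have "dim ?E \<le> card (S \<union> T)"
      unfolding dim_span by (intro order_trans[OF dim_le_card[OF span_superset] card_image_le]) auto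
    ultimately have "dim ?E < DIM(real^'n)" by simp
    \<comment> \<open>Euclidean orthogonality to all \<open>A *v w k\<close> is orthogonality to
      \<open>w k\<close> for \<open>A\<close>. A nonzero such \<open>x\<close> exists: since
      \<open>t\<close> lies outside \<open>S \<union> T\<close>, these vectors are too few to span
      the space.\<close>
    then obtain x where x: "x \<noteq> 0" "\<And>y. y \<in> span ?E \<Longrightarrow> orthogonal x y"
      using orthogonal_to_subspace_exists[of ?E] by blast
    have xw: "x \<bullet> (A *v w k) = 0" "w k \<bullet> (A *v x) = 0" if "k \<in> S \<union> T" for k
      using x(2)[of "A *v w k"] that sym[of "w k" x] by (auto simp: orthogonal_def intro!: span_base)
    let ?c = "sqrt (x \<bullet> (A *v x))"
    have c: "?c > 0" using pos[OF x(1)] by simp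
    show ?case
    proof (intro exI[of _ "w(t := (1 / ?c) *\<^sub>R x)"] conjI)
      show "\<forall>k\<in>S. (w(t := (1 / ?c) *\<^sub>R x)) k = v k" using w insert.prems by auto
      have "((1 / ?c) *\<^sub>R x) \<bullet> (A *v ((1 / ?c) *\<^sub>R x)) = 1"
        using pos[OF x(1)] by (simp add: matrix_vector_mult_scaleR)
      then show "\<forall>k\<in>S \<union> insert t T. \<forall>l\<in>S \<union> insert t T.
          (w(t := (1 / ?c) *\<^sub>R x)) k \<bullet> (A *v (w(t := (1 / ?c) *\<^sub>R x)) l) = of_bool (k = l)"
        using w xw \<open>t \<notin> S \<union> T\<close> by (auto simp: matrix_vector_mult_scaleR)
    qed
  qed
  from this[of "UNIV - S"] show ?thesis using that by auto
qed

lemma pos_def_matrix_inv: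
  fixes \<Sigma> :: "real^'n^'n"
  assumes "pos_def_matrix \<Sigma>"
  shows "\<Sigma> *v (matrix_inv \<Sigma> *v x) = x" "matrix_inv \<Sigma> *v (\<Sigma> *v x) = x"
    "matrix_inv \<Sigma> ** \<Sigma> = mat 1"
    "x \<bullet> (matrix_inv \<Sigma> *v y) = y \<bullet> (matrix_inv \<Sigma> *v x)"
    "x \<noteq> 0 \<Longrightarrow> 0 < x \<bullet> (matrix_inv \<Sigma> *v x)"
proof -
  have sym: "transpose \<Sigma> = \<Sigma>" and pos: "x \<noteq> 0 \<Longrightarrow> 0 < x \<bullet> (\<Sigma> *v x)" for x
    using assms by (auto simp: pos_def_matrix_def)
  have "\<forall>x. \<Sigma> *v x = 0 \<longrightarrow> x = 0" using pos by (metis inner_zero_right less_irrefl)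
  then have "invertible \<Sigma>" using matrix_left_invertible_ker invertible_left_inverse by blast
  then have inv: "\<Sigma> ** matrix_inv \<Sigma> = mat 1" "matrix_inv \<Sigma> ** \<Sigma> = mat 1"
    using someI_ex[of "\<lambda>A'. \<Sigma> ** A' = mat 1 \<and> A' ** \<Sigma> = mat 1"]
    unfolding matrix_inv_def invertible_def by auto
  then show 1: "\<Sigma> *v (matrix_inv \<Sigma> *v x) = x" and "matrix_inv \<Sigma> *v (\<Sigma> *v x) = x"
    and "matrix_inv \<Sigma> ** \<Sigma> = mat 1" for x
    by (simp_all add: matrix_vector_mul_assoc)
  have dot: "x \<bullet> (\<Sigma> *v y) = y \<bullet> (\<Sigma> *v x)" for x y
    using dot_lmul_matrix[of x \<Sigma> y] sym vector_transpose_matrix[of x \<Sigma>] by (simp add: inner_commute)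
  show "x \<bullet> (matrix_inv \<Sigma> *v y) = y \<bullet> (matrix_inv \<Sigma> *v x)" for x y
    using dot[of "matrix_inv \<Sigma> *v x" "matrix_inv \<Sigma> *v y"] by (simp add: 1 inner_commute)
  show "0 < x \<bullet> (matrix_inv \<Sigma> *v x)" if "x \<noteq> 0" for x
    using pos[of "matrix_inv \<Sigma> *v x"] that 1[of x] by (metis inner_commute matrix_vector_mult_0_right)
qed

text \<open>The columns of \<open>W\<close> are orthonormal for \<open>matrix_inv \<Sigma>\<close>.
  Hence \<open>W\<close> carries the Euclidean norm to the elliptical quadratic form, and (det W)^2
  = det \<Sigma> matches the Jacobian with the normalizing factor.\<close>

lemma elliptical_eq_distr_spherical:
  fixes \<Sigma> W :: "real^'n^'n"
  assumes pd: "pos_def_matrix \<Sigma>" and g: "g \<in> borel_measurable (restrict_space borel {0..})"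
    and W: "transpose W ** (matrix_inv \<Sigma> ** W) = mat 1"
  shows "elliptical 0 \<Sigma> g = distr (elliptical 0 (mat 1) g) borel ((*v) W)"
proof -
  let ?q = "\<lambda>x. x \<bullet> (matrix_inv \<Sigma> *v x)"
  note [measurable] = borel_measurable_generator_comp[OF g]
  have q: "0 \<le> ?q x" for x
    using pos_def_matrix_inv(5)[OF pd, of x] by (cases "x = 0") auto
  have [measurable]: "(*v) A \<in> borel_measurable borel" for A :: "real^'n^'n"
    by (intro borel_measurable_continuous_onI matrix_vector_mult_linear_continuous_on)
  have qW: "?q (W *v z) = z \<bullet> z" for z
  proof -
    have "?q (W *v z) = z \<bullet> (transpose W *v (matrix_inv \<Sigma> *v (W *v z)))"
      using dot_lmul_matrix[of z "transpose W"] by (simp add: vector_transpose_matrix)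
    also have "transpose W *v (matrix_inv \<Sigma> *v (W *v z)) = z"
      using W by (simp add: matrix_vector_mul_assoc matrix_mul_assoc)
    finally show ?thesis .
  qed
  have d: "det W * det W * det (matrix_inv \<Sigma>) = 1" "det (matrix_inv \<Sigma>) * det \<Sigma> = 1"
    using arg_cong[OF W, of det] arg_cong[OF pos_def_matrix_inv(3)[OF pd], of det] by (simp_all add: det_mul mult_ac)
  have "det \<Sigma> = det \<Sigma> * (det W * det W * det (matrix_inv \<Sigma>))" unfolding d by simp
  also have "\<dots> = (det W)\<^sup>2 * (det (matrix_inv \<Sigma>) * det \<Sigma>)" by (simp add: power2_eq_square)
  also have "\<dots> = (det W)\<^sup>2" unfolding d by simp
  finally have "det \<Sigma> = (det W)\<^sup>2" .
  then have dW: "det W \<noteq> 0" "sqrt (det \<Sigma>) = \<bar>det W\<bar>"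
    using d by auto
  have "distr (elliptical 0 (mat 1) g) borel ((*v) W) = distr (density lborel (\<lambda>z. g (?q (W *v z)))) borel ((*v) W)"
    by (simp add: elliptical_mat_1 qW)
  also have "\<dots> = density (distr lborel borel ((*v) W)) (\<lambda>x. g (?q x))"
    using q by (subst density_distr) auto
  also have "distr lborel borel ((*v) W) = density lborel (\<lambda>_. ennreal (1 / \<bar>det W\<bar>))"
    using distr_lborel_linear[of "(*v) W"] dW by simp
  also have "density (density lborel (\<lambda>_. ennreal (1 / \<bar>det W\<bar>))) (\<lambda>x. g (?q x)) = elliptical 0 \<Sigma> g"
    unfolding elliptical_def using q by (subst density_density_eq) (auto simp: dW)
  finally show ?thesis ..
qed

text \<open>A factor of \<Sigma> in the manner of Cholesky has to be explicit in two rows only: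
  coordinate \<open>i\<close> is kept, and coordinate \<open>j\<close> mixes both with s^2 = 1 -
  r^2, where r is their correlation. The first row gives the margins, both rows give the
  quadrants.\<close>

lemma correlation_elliptical_eq_distr_spherical:
  fixes \<Sigma> :: "real^'n^'n"
  assumes \<Sigma>: "correlation_matrix \<Sigma>" and g: "g \<in> borel_measurable (restrict_space borel {0..})"
    and ij: "i \<noteq> j"
  obtains W s where "0 < s" "\<And>z. (W *v z) $ i = z $ i"
    "\<And>z. (W *v z) $ j = \<Sigma> $ i $ j * z $ i + s * z $ j"
    "elliptical 0 \<Sigma> g = distr (elliptical 0 (mat 1) g) borel ((*v) W)"
proof -
  let ?A = "matrix_inv \<Sigma>" and ?r = "\<Sigma> $ i $ j"
  have pd: "pos_def_matrix \<Sigma>" and diag: "\<Sigma> $ k $ k = 1" for k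
    using \<Sigma> by (auto simp: correlation_matrix_def)
  note inv = pos_def_matrix_inv[OF pd]
  have sym: "\<Sigma> $ k $ l = \<Sigma> $ l $ k" for k l
    using pd by (auto simp: pos_def_matrix_def transpose_def vec_eq_iff)
  have pos: "0 < x \<bullet> (\<Sigma> *v x)" if "x \<noteq> 0" for x
    using pd that by (auto simp: pos_def_matrix_def)
  let ?e = "\<lambda>k. axis k 1 :: real^'n"
  have e: "?e k \<bullet> (\<Sigma> *v ?e l) = \<Sigma> $ k $ l" for k l
    by (simp add: inner_axis' matrix_vector_mul_component inner_axis)
  \<comment> \<open>\<open>u\<close> is \<open>axis j 1\<close> minus its projection onto
    \<open>axis i 1\<close> in the inner product of \<Sigma>. Its squared length 1 - r^2 is
    positive, which makes \<open>s\<close> well defined and nonzero.\<close>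
  define u where "u = ?e j - ?r *\<^sub>R ?e i"
  have uu: "u \<bullet> (\<Sigma> *v u) = 1 - ?r\<^sup>2"
    by (simp add: u_def algebra_simps inner_diff_left inner_diff_right matrix_vector_mult_diff_distrib
        matrix_vector_mult_scaleR e diag sym[of j i] power2_eq_square)
  have "u $ j = 1" using ij by (simp add: u_def axis_def)
  then have "u \<noteq> 0" by (metis zero_index zero_neq_one)
  then have r: "0 < 1 - ?r\<^sup>2" using pos[of u] uu by simp
  define s where "s = sqrt (1 - ?r\<^sup>2)"
  have s: "0 < s" "s * s = 1 - ?r\<^sup>2" using r by (auto simp: s_def)
  have eu: "?e i \<bullet> (\<Sigma> *v u) = 0" "u \<bullet> (\<Sigma> *v ?e i) = 0"
    by (simp_all add: u_def algebra_simps inner_diff_left inner_diff_right matrix_vector_mult_diff_distrib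
        matrix_vector_mult_scaleR e diag sym[of j i] power2_eq_square)
  define v where "v k = (if k = i then \<Sigma> *v ?e i else (1 / s) *\<^sub>R (\<Sigma> *v u))" for k
  have A: "(\<Sigma> *v x) \<bullet> (?A *v y) = x \<bullet> y" for x y
    using inv(4)[of "\<Sigma> *v x" y] by (simp add: inv inner_commute)
  have v: "v k \<bullet> (?A *v v l) = of_bool (k = l)" if "k \<in> {i, j}" "l \<in> {i, j}" for k l
    using that ij s uu eu
    by (auto simp: v_def matrix_vector_mult_scaleR inv(2) A e diag inner_commute[of "\<Sigma> *v _"] field_simps)
  text \<open>\<open>v i\<close> and \<open>v j\<close> are chosen so that their dual coordinates are \<open>x\<^sub>i\<close> and \<open>(x\<^sub>j - r x\<^sub>i) / s\<close>.\<close>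
  obtain w where w: "\<And>k. k \<in> {i, j} \<Longrightarrow> w k = v k" "\<And>k l. w k \<bullet> (?A *v w l) = of_bool (k = l)"
    using extend_orthonormal[of ?A "{i, j}" v, OF inv(4) inv(5) v] by metis
  define W :: "real^'n^'n" where "W = (\<chi> a k. w k $ a)"
  have W: "transpose W ** (?A ** W) = mat 1"
  proof -
    have "(transpose W ** (?A ** W)) $ k $ l = w k \<bullet> (?A *v w l)" for k l
      by (simp add: W_def matrix_matrix_mult_def transpose_def matrix_vector_mult_def inner_vec_def)
    then show ?thesis by (simp add: vec_eq_iff w mat_def)
  qed
  have z: "w k \<bullet> (?A *v (W *v z)) = z $ k" for k z
  proof -
    have "w k \<bullet> (?A *v (W *v z)) = (transpose W *v (?A *v (W *v z))) $ k"
      by (simp add: W_def matrix_vector_mul_component transpose_def inner_vec_def)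
    also have "transpose W *v (?A *v (W *v z)) = z"
      using W by (simp add: matrix_vector_mul_assoc matrix_mul_assoc)
    finally show ?thesis .
  qed
  show ?thesis
  proof (rule that)
    show 1: "(W *v z) $ i = z $ i" for z
      using z[of i z] by (simp add: w v_def A inner_axis')
    have "u \<bullet> (W *v z) = s * z $ j" for z
      using z[of j z] ij s by (simp add: w v_def A field_simps)
    then show "(W *v z) $ j = ?r * z $ i + s * z $ j" for z
      using 1[of z] by (simp add: u_def inner_diff_left inner_axis' algebra_simps)
  qed (use s elliptical_eq_distr_spherical[OF pd g W] in auto)
qed

section \<open>Quadrant probabilities\<close>

lemma emeasure_lborel_open_pos:
  fixes S :: "'a::euclidean_space set"
  assumes "open S" "x \<in> S"
  shows "emeasure lborel S \<noteq> 0"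
proof
  assume "emeasure lborel S = 0"
  then have "S \<in> null_sets lborel" using \<open>open S\<close> by auto
  then have "AE x in lborel. x \<notin> S" by (rule AE_not_in)
  then have "AE x\<in>S in lborel. x \<in> {}" by eventually_elim auto
  then have "AE x\<in>S in lebesgue. x \<in> {}" by (rule AE_completion)
  then have "x \<in> {}" using mem_closed_if_AE_lebesgue_open assms by blast
  then show False by simp
qed

lemma measure_spherical_open_pos:
  fixes S :: "(real^'n) set"
  assumes "density_generator CARD('n) g" and pos: "\<And>t. 0 \<le> t \<Longrightarrow> 0 < g t" and "open S" "x \<in> S"
  shows "0 < measure (elliptical 0 (mat 1 :: real^'n^'n) g) S"
proof -
  have g: "g \<in> borel_measurable (restrict_space borel {0..})"
    using assms by (simp add: density_generator_def)
  note [measurable] = borel_measurable_generator_comp[OF g]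
  interpret prob_space "elliptical 0 (mat 1 :: real^'n^'n) g"
    by (rule prob_space_spherical) fact
  have [measurable]: "S \<in> sets borel" using \<open>open S\<close> by simp
  have "emeasure (elliptical 0 (mat 1 :: real^'n^'n) g) S \<noteq> 0"
  proof
    assume "emeasure (elliptical 0 (mat 1 :: real^'n^'n) g) S = 0"
    then have "(\<integral>\<^sup>+x. g (x \<bullet> x) * indicator S x \<partial>(lborel :: (real^'n) measure)) = 0"
      by (simp add: elliptical_mat_1 emeasure_density)
    then have "AE x in (lborel :: (real^'n) measure). g (x \<bullet> x) * indicator S x = 0"
      by (subst (asm) nn_integral_0_iff_AE) auto
    then have "AE x in (lborel :: (real^'n) measure). x \<notin> S"
      using pos by (auto elim!: eventually_mono split: split_indicator_asm) (metis inner_ge_zero less_irrefl)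
    then have "emeasure lborel S = 0"
      by (subst (asm) AE_iff_measurable[of S]) auto
    then show False using emeasure_lborel_open_pos[OF assms(3,4)] by simp
  qed
  then show ?thesis by (simp add: emeasure_eq_measure zero_less_measure_iff)
qed

lemma distr_spherical_orthogonal:
  fixes f :: "real^'n \<Rightarrow> real^'n"
  assumes f: "orthogonal_transformation f" and g: "g \<in> borel_measurable (restrict_space borel {0..})"
  shows "distr (elliptical 0 (mat 1) g) borel f = elliptical 0 (mat 1) g"
proof -
  note [measurable] = borel_measurable_generator_comp[OF g]
  have lin: "linear f" and ip: "f x \<bullet> f x = x \<bullet> x" for x
    using f by (auto simp: orthogonal_transformation_def)
  have [measurable]: "f \<in> borel_measurable borel"
    using lin by (intro borel_measurable_continuous_onI linear_continuous_on)
      (simp add: linear_conv_bounded_linear)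
  have D: "\<bar>det (matrix f)\<bar> = 1" using f by (rule orthogonal_transformation_det)
  then have "distr lborel borel f = lborel"
    using distr_lborel_linear[OF lin] by (auto simp: density_1)
  then have "density (distr lborel borel f) (\<lambda>x. g (x \<bullet> x)) = elliptical 0 (mat 1) g"
    by (simp add: elliptical_mat_1)
  then show ?thesis
    by (subst (asm) density_distr) (auto simp: ip elliptical_mat_1)
qed

section \<open>One-dimensional margins: cdf, quantile function and symmetry\<close>

lemma marginal_density_minus: "marginal_density d g (- t) = marginal_density d g t"
  by (simp add: marginal_density_def)

text \<open>Measurability and unit mass of the margin form the setting, so that it covers the
  generator behind \<open>c\<close> as well as the two regular ones.\<close>

locale marginal_law =
  fixes d :: nat and g :: "real \<Rightarrow> ennreal"
  assumes generator: "g \<in> borel_measurable (restrict_space borel {0..})"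
    and prob_margin: "prob_space (density lborel (marginal_density d g))"
begin

abbreviation "f \<equiv> marginal_density d g"
abbreviation "F \<equiv> marginal_cdf d g"
abbreviation "Q \<equiv> marginal_quantile d g"

lemma borel_measurable_f [measurable]: "f \<in> borel_measurable borel"
  by (rule borel_measurable_marginal_density[OF generator])

sublocale N: cdf_distribution "density lborel f"
  by (intro cdf_distribution.intro real_distribution.intro prob_margin real_distribution_axioms.intro) auto

lemma cdf_margin: "cdf (density lborel f) = F"
  by (simp add: fun_eq_iff cdf_def measure_def emeasure_density marginal_cdf_def)

lemma emeasure_margin: "emeasure (density lborel f) {..x} = ennreal (F x)"
  using N.emeasure_eq_measure[of "{..x}"] cdf_margin by (simp add: cdf_def fun_eq_iff)

lemma measure_singleton: "measure (density lborel f) {x} = 0"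
proof -
  have "emeasure (density lborel f) {x} = (\<integral>\<^sup>+t. f t * indicator {x} t \<partial>lborel)"
    by (simp add: emeasure_density)
  also have "\<dots> = (\<integral>\<^sup>+t. 0 \<partial>(lborel :: real measure))"
    using AE_lborel_singleton[of x] by (intro nn_integral_cong_AE, eventually_elim) simp
  finally show ?thesis by (simp add: measure_def)
qed

lemma isCont_F: "isCont F x"
  using N.isCont_cdf[of x] measure_singleton by (simp add: cdf_margin)

lemma mono_F: "x \<le> y \<Longrightarrow> F x \<le> F y"
  using N.cdf_nondecreasing by (simp add: cdf_margin)

lemma F_bounds: "0 \<le> F x" "F x \<le> 1"
  using N.cdf_nonneg N.cdf_bounded_prob by (auto simp: cdf_margin)

text \<open>Right continuity of the cdf makes the infimum in \<open>Q\<close> attained. This Galois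
  connection is the main access to \<open>Q\<close> below.\<close>

lemma Q_le_iff: "0 < u \<Longrightarrow> u < 1 \<Longrightarrow> Q u \<le> t \<longleftrightarrow> u \<le> F t"
  using N.pseudoinverse[of u t] by (simp add: cdf_margin marginal_quantile_def)

text \<open>If \<open>F\<close> exceeded \<open>u\<close> at \<open>Q u\<close>, continuity would
  make it exceed \<open>u\<close> slightly to the left as well, although \<open>Q u\<close> is the
  least point where \<open>F\<close> reaches \<open>u\<close>.\<close>

lemma F_Q: assumes "0 < u" "u < 1" shows "F (Q u) = u"
proof (rule ccontr)
  assume "F (Q u) \<noteq> u"
  then have "u < F (Q u)" using Q_le_iff[OF assms, of "Q u"] by simp
  then have "eventually (\<lambda>t. u < F t) (at (Q u))"
    using isCont_F[of "Q u"] by (simp add: isCont_def order_tendstoD(1))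
  then have "eventually (\<lambda>t. u < F t) (at_left (Q u))"
    by (simp add: eventually_at_split)
  then obtain b where b: "b < Q u" "\<And>t. b < t \<Longrightarrow> t < Q u \<Longrightarrow> u < F t"
    using eventually_at_left[of "Q u - 1" "Q u"] by auto
  then obtain t where "t < Q u" "u < F t" using dense[OF b(1)] by blast
  then show False using Q_le_iff[OF assms, of t] by simp
qed

lemma F_minus: "F (- x) = 1 - F x"
proof -
  have "emeasure (density lborel f) {..- x} = (\<integral>\<^sup>+t. f t * indicator {..- x} t \<partial>lborel)"
    by (simp add: emeasure_density)
  also have "\<dots> = (\<integral>\<^sup>+t. f t * indicator {x..} t \<partial>lborel)"
    using nn_integral_real_affine[of "\<lambda>t. f t * indicator {..- x} t" "-1" 0]
    by (auto simp: marginal_density_minus indicator_def cong: nn_integral_cong_simp)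
  also have "\<dots> = (\<integral>\<^sup>+t. f t * indicator {x<..} t \<partial>lborel)"
    using AE_lborel_singleton[of x]
    by (intro nn_integral_cong_AE, eventually_elim) (auto split: split_indicator)
  also have "\<dots> = emeasure (density lborel f) {x<..}"
    by (simp add: emeasure_density)
  finally have "measure (density lborel f) {..- x} = measure (density lborel f) {x<..}"
    by (simp add: measure_def)
  also have "{x<..} = space (density lborel f) - {..x}" by auto
  finally show ?thesis
    using N.prob_compl[of "{..x}"] by (simp add: cdf_margin[symmetric] cdf_def)
qed

lemma F_0: "F 0 = 1 / 2"
  using F_minus[of 0] by simp

end

lemma marginal_law_spherical:
  assumes "density_generator CARD('n::finite) g" "2 \<le> CARD('n)"
  shows "marginal_law CARD('n) g"
proof (rule marginal_law.intro)
  show g: "g \<in> borel_measurable (restrict_space borel {0..})"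
    using assms by (simp add: density_generator_def)
  interpret prob_space "elliptical 0 (mat 1 :: real^'n^'n) g"
    by (rule prob_space_spherical) fact
  have "(\<lambda>x. x $ (SOME k. True)) \<in> borel_measurable (elliptical 0 (mat 1 :: real^'n^'n) g)"
    by (simp add: elliptical_def)
  then have "prob_space (margin (elliptical 0 (mat 1 :: real^'n^'n) g) (SOME k. True))"
    unfolding margin_def by (rule prob_space_distr)
  then show "prob_space (density lborel (marginal_density CARD('n) g))"
    using margin_spherical[OF g assms(2)] by simp
qed

text \<open>Reflecting coordinate \<open>j\<close> preserves the spherical law, so it splits the
  half space of mass 1/2 into two parts of equal mass; the common boundary is null.\<close>

lemma measure_spherical_quadrant:
  fixes i j :: "'n::finite"
  assumes dg: "density_generator CARD('n) g" and card: "2 \<le> CARD('n)" and "i \<noteq> j"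
  shows "measure (elliptical 0 (mat 1 :: real^'n^'n) g) {x. x $ i \<le> 0 \<and> x $ j \<le> 0} = 1 / 4"
proof -
  let ?P = "elliptical 0 (mat 1 :: real^'n^'n) g"
  have g: "g \<in> borel_measurable (restrict_space borel {0..})"
    using dg by (simp add: density_generator_def)
  interpret P: prob_space ?P by (rule prob_space_spherical) fact
  interpret marginal_law "CARD('n)" g by (rule marginal_law_spherical) fact+
  have sets[measurable_cong, simp]: "sets ?P = sets borel" by (simp add: elliptical_def)
  have space[simp]: "space ?P = UNIV" by (simp add: elliptical_def)
  have mar: "measure ?P {x. x $ k \<in> S} = measure (density lborel f) S" if "S \<in> sets borel" for S and k :: 'n
    using that measure_distr[of "\<lambda>x. x $ k" ?P borel S] margin_spherical[OF g card, of k]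
    by (auto simp: margin_def vimage_def)
  have half: "measure ?P {x. x $ i \<le> 0} = 1 / 2"
    using mar[of "{..0}" i] F_0 by (simp add: cdf_margin[symmetric] cdf_def)
  have null: "measure ?P {x. x $ j = 0} = 0"
    using mar[of "{0}" j] measure_singleton by simp
  let ?s = "\<lambda>x :: real^'n. \<chi> l. if l = j then - x $ l else x $ l"
  have "orthogonal_transformation ?s"
    unfolding orthogonal_transformation_def
    by (auto intro!: linearI sum.cong simp: vec_eq_iff inner_vec_def)
  then have inv: "distr ?P borel ?s = ?P" by (rule distr_spherical_orthogonal[OF _ g])
  have [measurable]: "?s \<in> borel_measurable borel"
    by (intro borel_measurable_vec_lambda) auto
  have "measure ?P {x. x $ i \<le> 0 \<and> x $ j \<le> 0} = measure (distr ?P borel ?s) {x. x $ i \<le> 0 \<and> x $ j \<le> 0}"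
    unfolding inv ..
  also have "\<dots> = measure ?P {x. x $ i \<le> 0 \<and> 0 \<le> x $ j}"
    using \<open>i \<noteq> j\<close> by (subst measure_distr) (auto simp: vimage_def)
  also have "\<dots> = measure ?P {x. x $ i \<le> 0 \<and> 0 < x $ j} + measure ?P {x. x $ i \<le> 0 \<and> x $ j = 0}"
    by (subst P.finite_measure_Union[symmetric]) (auto intro!: arg_cong[where f = "measure _"])
  also have "measure ?P {x. x $ i \<le> 0 \<and> x $ j = 0} = 0"
    using P.finite_measure_mono[of "{x. x $ i \<le> 0 \<and> x $ j = 0}" "{x. x $ j = 0}"] null
    by (auto simp: measure_le_0_iff)
  finally have "measure ?P {x. x $ i \<le> 0 \<and> x $ j \<le> 0} = measure ?P {x. x $ i \<le> 0 \<and> 0 < x $ j}" by simp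
  moreover have "measure ?P {x. x $ i \<le> 0} =
      measure ?P {x. x $ i \<le> 0 \<and> x $ j \<le> 0} + measure ?P {x. x $ i \<le> 0 \<and> 0 < x $ j}"
    by (subst P.finite_measure_Union[symmetric]) (auto intro!: arg_cong[where f = "measure _"])
  ultimately show ?thesis using half by simp
qed

text \<open>The factor \<open>W\<close> turns the quadrant event for \<Sigma> into the wedge
  \<open>?B\<close> under the spherical law. For r > 0 the wedge contains the quadrant
  \<open>?A\<close> and an open cone disjoint from it; for r < 0 the roles are exchanged. The cone
  has positive mass, so both probabilities cannot be 1/4.\<close>

lemma correlation_matrix_eq_mat_1:
  fixes \<Sigma> :: "real^'n^'n"
  assumes \<Sigma>: "correlation_matrix \<Sigma>" and dg: "density_generator CARD('n) g" and card: "2 \<le> CARD('n)"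
    and pos: "\<And>t. 0 \<le> t \<Longrightarrow> 0 < g t"
    and quad: "\<And>i j. i \<noteq> j \<Longrightarrow> measure (elliptical 0 \<Sigma> g) {x. x $ i \<le> 0 \<and> x $ j \<le> 0} = 1 / 4"
  shows "\<Sigma> = mat 1"
proof -
  let ?P = "elliptical 0 (mat 1 :: real^'n^'n) g"
  have g: "g \<in> borel_measurable (restrict_space borel {0..})"
    using dg by (simp add: density_generator_def)
  interpret P: prob_space ?P by (rule prob_space_spherical) fact
  have sets[measurable_cong, simp]: "sets ?P = sets borel" by (simp add: elliptical_def)
  have space[simp]: "space ?P = UNIV" by (simp add: elliptical_def)
  have "\<Sigma> $ i $ j = 0" if ij: "i \<noteq> j" for i j
  proof (rule ccontr)
    let ?r = "\<Sigma> $ i $ j"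
    assume r: "?r \<noteq> 0"
    obtain s W where s: "0 < s" and Wi: "\<And>z. (W *v z) $ i = z $ i"
      and Wj: "\<And>z. (W *v z) $ j = ?r * z $ i + s * z $ j"
      and W: "elliptical 0 \<Sigma> g = distr ?P borel ((*v) W)"
      by (rule correlation_elliptical_eq_distr_spherical[OF \<Sigma> g ij]) (rule that)
    have [measurable]: "(*v) W \<in> borel_measurable borel"
      by (intro borel_measurable_continuous_onI matrix_vector_mult_linear_continuous_on)
    let ?A = "{z :: real^'n. z $ i \<le> 0 \<and> z $ j \<le> 0}" and ?B = "{z :: real^'n. z $ i \<le> 0 \<and> ?r * z $ i + s * z $ j \<le> 0}"
    have A: "measure ?P ?A = 1 / 4" by (rule measure_spherical_quadrant) fact+
    have "measure (elliptical 0 \<Sigma> g) ?A = measure ?P ?B"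
      unfolding W by (subst measure_distr) (auto simp: vimage_def Wi Wj)
    then have B: "measure ?P ?B = 1 / 4" using quad[OF ij] by simp
    have [measurable]: "?A \<in> sets borel" "?B \<in> sets borel" by measurable
    show False
    proof (cases "0 < ?r")
      case True
      let ?O = "{z :: real^'n. z $ i < 0 \<and> 0 < z $ j \<and> ?r * z $ i + s * z $ j < 0}"
      have O: "open ?O"
        by (intro open_Collect_conj open_Collect_less continuous_intros)
      \<comment> \<open>At this point the mixed coordinate r z_i + s z_j equals -r/2, so the same
        witness serves for both signs of r.\<close>
      have "(\<chi> k. if k = i then -1 else ?r / (2 * s)) \<in> ?O"
        using True s ij by simp
      from measure_spherical_open_pos[OF dg pos O this] have "0 < measure ?P ?O" .
      moreover have "measure ?P ?A + measure ?P ?O = measure ?P (?A \<union> ?O)"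
        using O by (intro P.finite_measure_Union[symmetric]) auto
      moreover have "measure ?P (?A \<union> ?O) \<le> measure ?P ?B"
      proof (intro P.finite_measure_mono)
        have "?r * z $ i + s * z $ j \<le> 0" if "z $ i \<le> 0" "z $ j \<le> 0" for z :: "real^'n"
          using True s that by (intro add_nonpos_nonpos mult_nonneg_nonpos) auto
        then show "?A \<union> ?O \<subseteq> ?B" by auto
      qed simp
      ultimately show False using A B by simp
    next
      case False
      with r have r: "?r < 0" by simp
      let ?O = "{z :: real^'n. z $ i < 0 \<and> z $ j < 0 \<and> 0 < ?r * z $ i + s * z $ j}"
      have O: "open ?O"
        by (intro open_Collect_conj open_Collect_less continuous_intros)
      have "(\<chi> k. if k = i then -1 else ?r / (2 * s)) \<in> ?O"
        using r s ij by (simp add: divide_neg_pos)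
      from measure_spherical_open_pos[OF dg pos O this] have "0 < measure ?P ?O" .
      moreover have "measure ?P ?B + measure ?P ?O = measure ?P (?B \<union> ?O)"
        using O by (intro P.finite_measure_Union[symmetric]) auto
      moreover have "measure ?P (?B \<union> ?O) \<le> measure ?P ?A"
      proof (intro P.finite_measure_mono)
        have "z $ j \<le> 0" if "z $ i \<le> 0" "?r * z $ i + s * z $ j \<le> 0" for z :: "real^'n"
        proof -
          have "0 \<le> ?r * z $ i" using r that by (simp add: mult_nonpos_nonpos)
          then have "s * z $ j \<le> 0" using that by simp
          then show ?thesis using s by (simp add: mult_le_0_iff)
        qed
        then show "?B \<union> ?O \<subseteq> ?A" by auto
      qed simp
      ultimately show False using A B by simp
    qed
  qed
  then show ?thesis
    using \<Sigma> by (auto simp: vec_eq_iff mat_def correlation_matrix_def)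
qed

section \<open>Sklar's relation\<close>

lemma atMost_cart: "{..x} = {y :: real^'n. \<forall>k. y $ k \<le> x $ k}"
  by (auto simp: less_eq_vec_def)

text \<open>A copula constrains \<open>joint_cdf P\<close> only on the unit cube, and the margins of
  \<open>P\<close> are not given. The mass is located through the values at points with one
  coordinate t and all others 1: t = 0 and t = 1 exclude the outside and the lower faces, and t
  close to 1 excludes the upper faces.\<close>

lemma copula_AE_in_cube:
  fixes P :: "(real^'n) measure"
  assumes C: "copula (joint_cdf P)" and P: "prob_space P" "sets P = sets borel"
  shows "AE u in P. \<forall>k. 0 < u $ k \<and> u $ k < 1"
proof -
  interpret P: prob_space P by fact
  have [measurable_cong, simp]: "sets P = sets borel" by fact
  have [simp]: "space P = UNIV" using sets_eq_imp_space_eq[OF P(2)] by simp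
  obtain P' where P': "prob_space P'" "sets P' = sets borel"
    and mar: "\<And>k. margin P' k = uniform_measure lborel {0..1}"
    and eq: "\<And>u. (\<And>k. u $ k \<in> {0..1}) \<Longrightarrow> joint_cdf P u = joint_cdf P' u"
    using C unfolding copula_def by auto
  interpret P': prob_space P' by fact
  have [measurable_cong, simp]: "sets P' = sets borel" by fact
  have [simp]: "space P' = UNIV" using sets_eq_imp_space_eq[OF P'(2)] by simp
  have le: "measure P' {y. y $ k \<le> t} = t" if "0 \<le> t" "t \<le> 1" for t k
  proof -
    have "measure P' {y. y $ k \<le> t} = measure (margin P' k) {..t}"
      by (simp add: margin_def measure_distr vimage_def)
    also have "\<dots> = measure lborel ({0..1} \<inter> {..t}) / measure lborel {0..1::real}"
      unfolding mar by (subst measure_uniform_measure) auto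
    also have "{0..1} \<inter> {..t} = {0..t}" using that by auto
    finally show ?thesis using that by simp
  qed
  have slice: "measure P {y. y $ k \<le> t \<and> (\<forall>l. l \<noteq> k \<longrightarrow> y $ l \<le> 1)} = t" if "0 \<le> t" "t \<le> 1" for t k
  proof -
    let ?w = "\<chi> l. if l = k then t else 1"
    have "AE y in P'. y $ l \<le> 1" for l
      using le[of 1 l] by (subst P'.prob_Collect_eq_1[symmetric]) auto
    then have "AE y in P'. \<forall>l. y $ l \<le> 1" by (simp add: AE_all_countable)
    then have "measure P' {y. y $ k \<le> t} = measure P' {y. \<forall>l. y $ l \<le> ?w $ l}"
      by (intro P'.finite_measure_eq_AE) (auto elim!: eventually_mono)
    then have "joint_cdf P' ?w = t" using le[OF that] by (simp add: joint_cdf_def)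
    then have "joint_cdf P ?w = t" using eq[of ?w] that by auto
    moreover have "{y. \<forall>l. y $ l \<le> ?w $ l} = {y. y $ k \<le> t \<and> (\<forall>l. l \<noteq> k \<longrightarrow> y $ l \<le> 1)}"
      by auto
    ultimately show ?thesis by (simp add: joint_cdf_def)
  qed
  have "AE u in P. 0 < u $ k \<and> u $ k < 1" for k
  proof (rule AE_conjI)
    have "AE u in P. \<not> (u $ k \<le> 0 \<and> (\<forall>l. l \<noteq> k \<longrightarrow> u $ l \<le> 1))"
      using slice[of 0 k] by (subst P.prob_Collect_eq_0[symmetric]) auto
    moreover have "AE u in P. u $ k \<le> 1 \<and> (\<forall>l. l \<noteq> k \<longrightarrow> u $ l \<le> 1)"
      using slice[of 1 k] by (subst P.prob_Collect_eq_1[symmetric]) auto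
    ultimately show "AE u in P. 0 < u $ k"
      by eventually_elim auto
    have "1 \<le> measure P {u. u $ k < 1}"
    proof (rule field_le_epsilon)
      \<comment> \<open>Approaching 1 from below is what rules out mass on the face where coordinate
        \<open>k\<close> equals 1.\<close>
      fix e :: real assume e: "0 < e"
      let ?t = "max 0 (1 - e)"
      have "?t = measure P {y. y $ k \<le> ?t \<and> (\<forall>l. l \<noteq> k \<longrightarrow> y $ l \<le> 1)}"
        using e slice[of ?t k] by auto
      also have "\<dots> \<le> measure P {u. u $ k < 1}"
        using e by (intro P.finite_measure_mono) auto
      finally show "1 \<le> measure P {u. u $ k < 1} + e" by simp
    qed
    then have "measure P {u. u $ k < 1} = 1" using P.prob_le_1 by (simp add: antisym)
    then show "AE u in P. u $ k < 1" by (subst P.prob_Collect_eq_1[symmetric]) auto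
  qed
  then show ?thesis by (simp add: AE_all_countable)
qed

text \<open>Coordinate \<open>k\<close> plays the part of the one that the factor \<open>W\<close>
  leaves unchanged; a second index exists because the dimension is at least 2.\<close>

lemma margin_correlation_elliptical:
  fixes \<Sigma> :: "real^'n^'n"
  assumes \<Sigma>: "correlation_matrix \<Sigma>" and g: "g \<in> borel_measurable (restrict_space borel {0..})"
    and card: "2 \<le> CARD('n)"
  shows "margin (elliptical 0 \<Sigma> g) k = density lborel (marginal_density CARD('n) g)"
proof -
  have "\<exists>j. k \<noteq> j"
  proof (rule ccontr)
    assume "\<not> ?thesis"
    then have "UNIV = {k}" by auto
    then have "CARD('n) = 1" by (metis card_1_singleton_iff One_nat_def)
    then show False using card by simp
  qed
  then obtain j where "k \<noteq> j" ..
  then obtain s W where Wk: "\<And>z. (W *v z) $ k = z $ k"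
    and W: "elliptical 0 \<Sigma> g = distr (elliptical 0 (mat 1) g) borel ((*v) W)"
    by (rule correlation_elliptical_eq_distr_spherical[OF \<Sigma> g]) (rule that)
  have [measurable]: "(*v) W \<in> borel_measurable borel"
    by (intro borel_measurable_continuous_onI matrix_vector_mult_linear_continuous_on)
  have [measurable_cong]: "sets (elliptical 0 (mat 1 :: real^'n^'n) g) = sets borel"
    by (simp add: elliptical_def)
  have "margin (elliptical 0 \<Sigma> g) k = margin (elliptical 0 (mat 1) g) k"
    unfolding margin_def W by (subst distr_distr) (auto simp: Wk o_def)
  then show ?thesis using margin_spherical[OF g card] by simp
qed

lemma prob_space_correlation_elliptical:
  fixes \<Sigma> :: "real^'n^'n"
  assumes \<Sigma>: "correlation_matrix \<Sigma>" and dg: "density_generator CARD('n) g" and card: "2 \<le> CARD('n)"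
  shows "prob_space (elliptical 0 \<Sigma> g)"
proof -
  have g: "g \<in> borel_measurable (restrict_space borel {0..})"
    using dg by (simp add: density_generator_def)
  have "prob_space (margin (elliptical 0 \<Sigma> g) k)" for k
    using margin_correlation_elliptical[OF \<Sigma> g card]
      marginal_law.prob_margin[OF marginal_law_spherical[OF dg card]] by simp
  then have "emeasure (margin (elliptical 0 \<Sigma> g) (SOME k. True)) UNIV = 1"
    using prob_space.emeasure_space_1 by (fastforce simp: margin_def)
  then show ?thesis
    by (intro prob_spaceI) (auto simp: margin_def emeasure_distr elliptical_def)
qed

context marginal_law
begin

text \<open>The infimum \<open>Q u\<close> is only meaningful for \<open>0 < u < 1\<close>; a fixed value elsewhere keeps it measurable.\<close>

definition "quantile u = (if 0 < u \<and> u < 1 then Q u else 0)"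

lemma borel_measurable_quantile [measurable]: "quantile \<in> borel_measurable borel"
proof (rule borel_measurable_iff_le[THEN iffD2], rule allI)
  fix t
  have "{u. quantile u \<le> t} = ({0<..<1} \<inter> {..F t}) \<union> (if 0 \<le> t then - {0<..<1} else {})"
    by (auto simp: quantile_def Q_le_iff)
  then show "{u \<in> space borel. quantile u \<le> t} \<in> sets borel" by auto
qed

lemma borel_measurable_F [measurable]: "F \<in> borel_measurable borel"
  using isCont_F by (intro borel_measurable_continuous_onI continuous_at_imp_continuous_on) auto

lemma borel_measurable_quantile_cart [measurable]:
  "(\<lambda>u :: real^'n. \<chi> k. quantile (u $ k)) \<in> borel_measurable borel"
  by (intro borel_measurable_vec_lambda) measurable

text \<open>Sklar's relation solved for the law. On the open cube a quantile lies below
  \<open>x $ k\<close> exactly if \<open>u $ k\<close> lies below \<open>F (x $ k)\<close>, so both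
  laws give the same mass to every lower orthant.\<close>

lemma eq_distr_quantile:
  fixes \<mu> P :: "(real^'n) measure"
  assumes \<mu>: "prob_space \<mu>" "sets \<mu> = sets borel" "AE u in \<mu>. \<forall>k. 0 < u $ k \<and> u $ k < 1"
    and P: "prob_space P" "sets P = sets borel"
    and eq: "\<And>x. measure P {..x} = measure \<mu> {..(\<chi> k. F (x $ k))}"
  shows "P = distr \<mu> borel (\<lambda>u. \<chi> k. quantile (u $ k))"
proof (rule measure_eqI_atMost)
  interpret M: prob_space \<mu> by fact
  interpret P: prob_space P by fact
  have [measurable_cong, simp]: "sets \<mu> = sets borel" by fact
  have [simp]: "space \<mu> = UNIV" using sets_eq_imp_space_eq[OF \<mu>(2)] by simp
  show "emeasure P {..x} = emeasure (distr \<mu> borel (\<lambda>u. \<chi> k. quantile (u $ k))) {..x}" for x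
  proof -
    have "emeasure (distr \<mu> borel (\<lambda>u. \<chi> k. quantile (u $ k))) {..x} =
        emeasure \<mu> {u. \<forall>k. quantile (u $ k) \<le> x $ k}"
      by (subst emeasure_distr) (auto simp: vimage_def atMost_cart)
    also have "\<dots> = emeasure \<mu> {..(\<chi> k. F (x $ k))}"
    proof (rule emeasure_eq_AE)
      show "AE u in \<mu>. u \<in> {u. \<forall>k. quantile (u $ k) \<le> x $ k} \<longleftrightarrow> u \<in> {..(\<chi> k. F (x $ k))}"
        using \<mu>(3) by eventually_elim (simp add: atMost_cart quantile_def Q_le_iff)
    qed simp_all
    finally show ?thesis using eq by (simp add: M.emeasure_eq_measure P.emeasure_eq_measure)
  qed
  show "emeasure P {..x} \<noteq> \<infinity>" for x by simp
qed (use P in auto)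

end

lemma meta_elliptical_distr_quantile:
  fixes U :: "'a \<Rightarrow> real^'n"
  assumes \<Sigma>: "correlation_matrix \<Sigma>" and dg: "density_generator CARD('n) g" and card: "2 \<le> CARD('n)"
    and U: "meta_elliptical M U \<Sigma> g"
  shows "AE u in distr M borel U. \<forall>k. 0 < u $ k \<and> u $ k < 1" (is ?AE)
    and "elliptical 0 \<Sigma> g = distr (distr M borel U) borel (\<lambda>u. \<chi> k. marginal_law.quantile CARD('n) g (u $ k))"
proof -
  have g: "g \<in> borel_measurable (restrict_space borel {0..})"
    using dg by (simp add: density_generator_def)
  interpret marginal_law "CARD('n)" g by (rule marginal_law_spherical) fact+
  have M: "prob_space (distr M borel U)" and C: "copula (joint_cdf (distr M borel U))"
    and sk: "\<And>x. joint_cdf (elliptical 0 \<Sigma> g) x =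
      joint_cdf (distr M borel U) (\<chi> k. cdf (margin (elliptical 0 \<Sigma> g) k) (x $ k))"
    using U by (auto simp: meta_elliptical_def copula_of_def intro: prob_space.prob_space_distr)
  show AE: ?AE by (rule copula_AE_in_cube[OF C M]) simp
  show "elliptical 0 \<Sigma> g = distr (distr M borel U) borel (\<lambda>u. \<chi> k. quantile (u $ k))"
  proof (rule eq_distr_quantile[OF M _ AE prob_space_correlation_elliptical[OF \<Sigma> dg card]])
    show "measure (elliptical 0 \<Sigma> g) {..x} = measure (distr M borel U) {..(\<chi> k. F (x $ k))}" for x
      using sk[of x] margin_correlation_elliptical[OF \<Sigma> g card]
      by (simp add: joint_cdf_def atMost_cart cdf_margin)
  qed (auto simp: elliptical_def)
qed

text \<open>Every margin has median 0, whatever the generator. Hence the quadrant at the origin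
  corresponds to one fixed event for \<open>U\<close>, which permits comparing different generators
  and matrices.\<close>

lemma measure_elliptical_quadrant:
  fixes U :: "'a \<Rightarrow> real^'n"
  assumes \<Sigma>: "correlation_matrix \<Sigma>" and dg: "density_generator CARD('n) g" and card: "2 \<le> CARD('n)"
    and U: "meta_elliptical M U \<Sigma> g"
  shows "measure (elliptical 0 \<Sigma> g) {x. x $ i \<le> 0 \<and> x $ j \<le> 0} =
    measure (distr M borel U) {u. u $ i \<le> 1 / 2 \<and> u $ j \<le> 1 / 2}"
proof -
  interpret marginal_law "CARD('n)" g by (rule marginal_law_spherical) fact+
  interpret M: prob_space "distr M borel U"
    using U by (auto simp: meta_elliptical_def intro: prob_space.prob_space_distr)
  note D = meta_elliptical_distr_quantile[OF assms]
  have "measure (elliptical 0 \<Sigma> g) {x. x $ i \<le> 0 \<and> x $ j \<le> 0} =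
      measure (distr M borel U) {u. quantile (u $ i) \<le> 0 \<and> quantile (u $ j) \<le> 0}"
    unfolding D(2) by (subst measure_distr) (auto simp: vimage_def)
  also have "\<dots> = measure (distr M borel U) {u. u $ i \<le> 1 / 2 \<and> u $ j \<le> 1 / 2}"
  proof (rule M.finite_measure_eq_AE)
    show "AE u in distr M borel U. u \<in> {u. quantile (u $ i) \<le> 0 \<and> quantile (u $ j) \<le> 0} \<longleftrightarrow>
        u \<in> {u. u $ i \<le> 1 / 2 \<and> u $ j \<le> 1 / 2}"
      using D(1) by eventually_elim (simp add: quantile_def Q_le_iff F_0)
  qed simp_all
  finally show ?thesis .
qed

lemma correlation_matrix_mat_1: "correlation_matrix (mat 1 :: real^'n^'n)"
  by (auto simp: correlation_matrix_def pos_def_matrix_def transpose_mat) (simp add: mat_def)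

lemma meta_elliptical_independent_correlation:
  fixes U :: "'a \<Rightarrow> real^'n"
  assumes card: "2 \<le> CARD('n)"
    and dg: "density_generator CARD('n) g" and U: "meta_elliptical M U (mat 1) g"
    and \<Sigma>: "correlation_matrix \<Sigma>" and dg1: "density_generator CARD('n) g1"
    and pos: "\<And>t. 0 \<le> t \<Longrightarrow> 0 < g1 t" and U1: "meta_elliptical M U \<Sigma> g1"
  shows "\<Sigma> = mat 1"
  using measure_elliptical_quadrant[OF correlation_matrix_mat_1 dg card U]
    measure_elliptical_quadrant[OF \<Sigma> dg1 card U1] measure_spherical_quadrant[OF dg card]
  by (intro correlation_matrix_eq_mat_1[OF \<Sigma> dg1 card pos]) auto

section \<open>The density of the copula\<close>

lemma nn_integral_lborel_cart_prod:
  fixes h :: "'n::finite \<Rightarrow> real \<Rightarrow> ennreal"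
  assumes [measurable]: "\<And>k. h k \<in> borel_measurable borel"
  shows "(\<integral>\<^sup>+x. (\<Prod>k\<in>UNIV. h k ((x :: real^'n) $ k)) \<partial>lborel) = (\<Prod>k\<in>UNIV. \<integral>\<^sup>+t. h k t \<partial>lborel)"
proof -
  interpret product_sigma_finite "\<lambda>_::'n. lborel :: real measure" by standard
  have "(\<integral>\<^sup>+x. (\<Prod>k\<in>UNIV. h k ((x :: real^'n) $ k)) \<partial>lborel) =
      (\<integral>\<^sup>+y. (\<Prod>k\<in>UNIV. h k (y k)) \<partial>PiM UNIV (\<lambda>_. lborel))"
    by (subst nn_integral_lborel_cart) auto
  also have "\<dots> = (\<Prod>k\<in>UNIV. \<integral>\<^sup>+t. h k t \<partial>lborel)"
    by (rule product_nn_integral_prod) auto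
  finally show ?thesis .
qed

lemma emeasure_product_density_atMost:
  fixes h :: "real \<Rightarrow> ennreal" and x :: "real^'n"
  assumes [measurable]: "h \<in> borel_measurable borel"
  shows "emeasure (density lborel (\<lambda>x. \<Prod>k\<in>UNIV. h (x $ k))) {..x} =
    (\<Prod>k\<in>UNIV. emeasure (density lborel h) {..x $ k})"
proof -
  have "emeasure (density lborel (\<lambda>x. \<Prod>k\<in>UNIV. h (x $ k))) {..x} =
      (\<integral>\<^sup>+y. (\<Prod>k\<in>UNIV. h (y $ k) * indicator {..x $ k} (y $ k)) \<partial>lborel)"
  proof (subst emeasure_density)
    have "(\<Prod>k\<in>UNIV. h (y $ k)) * indicator {..x} y = (\<Prod>k\<in>UNIV. h (y $ k) * indicator {..x $ k} (y $ k))" for y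
    proof (cases "y \<le> x")
      case True
      then show ?thesis by (auto simp: less_eq_vec_def)
    next
      case False
      then obtain k where "\<not> y $ k \<le> x $ k" by (auto simp: less_eq_vec_def)
      then have "(\<Prod>k\<in>UNIV. h (y $ k) * indicator {..x $ k} (y $ k)) = 0"
        by (intro prod_zero bexI[of _ k]) auto
      then show ?thesis using False by simp
    qed
    then show "(\<integral>\<^sup>+y\<in>{..x}. (\<Prod>k\<in>UNIV. h (y $ k)) \<partial>lborel) =
      (\<integral>\<^sup>+y. (\<Prod>k\<in>UNIV. h (y $ k) * indicator {..x $ k} (y $ k)) \<partial>lborel)" by simp
  qed auto
  also have "\<dots> = (\<Prod>k\<in>UNIV. emeasure (density lborel h) {..x $ k})"
    by (subst nn_integral_lborel_cart_prod) (auto simp: emeasure_density)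
  finally show ?thesis .
qed

lemma prob_space_product_density:
  fixes h :: "real \<Rightarrow> ennreal"
  assumes [measurable]: "h \<in> borel_measurable borel" and "(\<integral>\<^sup>+t. h t \<partial>lborel) = 1"
  shows "prob_space (density lborel (\<lambda>x :: real^'n. \<Prod>k\<in>UNIV. h (x $ k)))"
  using nn_integral_lborel_cart_prod[where h = "\<lambda>_::'n. h"] assms(2)
  by (intro prob_spaceI) (simp add: emeasure_density)

text \<open>The uniform density on the open cube, written as a product so that the lemmas on product
  densities apply to it.\<close>

abbreviation cube_density :: "real^'n \<Rightarrow> ennreal" where
  "cube_density u \<equiv> \<Prod>k\<in>UNIV. indicator {0<..<1} (u $ k)"

lemma cube_density_eq: "cube_density u = of_bool (\<forall>k. 0 < u $ k \<and> u $ k < 1)"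
proof (cases "\<forall>k. 0 < u $ k \<and> u $ k < 1")
  case False
  then obtain k where "u $ k \<notin> {0<..<1}" by auto
  then have "cube_density u = 0" by (intro prod_zero bexI[of _ k]) auto
  then show ?thesis using False by simp
qed simp

context marginal_law
begin

lemma nn_integral_f: "(\<integral>\<^sup>+t. f t \<partial>lborel) = 1"
  using N.emeasure_space_1 by (simp add: emeasure_density)

text \<open>
  The product of the margins is the law with the same quantiles and the independence copula.
  Comparing the spherical law with it turns its density quotient into the copula density, without
  any differentiability of \<open>F\<close>.
\<close>

lemma product_margin_eq_distr_quantile:
  "density lborel (\<lambda>x :: real^'n. \<Prod>k\<in>UNIV. f (x $ k)) =
    distr (density lborel cube_density) borel (\<lambda>u. \<chi> k. quantile (u $ k))"
proof (rule eq_distr_quantile)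
  show "prob_space (density lborel (cube_density :: real^'n \<Rightarrow> ennreal))"
    using prob_space_product_density[of "indicator {0<..<1}", where 'n = 'n] by simp
  show "AE u in density lborel (cube_density :: real^'n \<Rightarrow> ennreal). \<forall>k. 0 < u $ k \<and> u $ k < 1"
    by (subst AE_density) (auto simp: cube_density_eq split: if_splits)
  show "prob_space (density lborel (\<lambda>x :: real^'n. \<Prod>k\<in>UNIV. f (x $ k)))"
    using prob_space_product_density[of f, where 'n = 'n] by (simp add: nn_integral_f)
  fix x :: "real^'n"
  have eq: "emeasure (density lborel (indicator {0<..<1})) {..F t} = ennreal (F t)" for t
  proof -
    have "emeasure (density lborel (indicator {0<..<1})) {..F t} = (\<integral>\<^sup>+u. indicator {0<..<1} u * indicator {..F t} u \<partial>lborel)"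
      by (simp add: emeasure_density)
    also have "\<dots> = (\<integral>\<^sup>+u. indicator {0..F t} u \<partial>lborel)"
      using AE_lborel_singleton[of "0 :: real"] AE_lborel_singleton[of "1 :: real"]
    proof (intro nn_integral_cong_AE, eventually_elim)
      case (elim u)
      then show ?case using F_bounds(2)[of t] by (auto split: split_indicator)
    qed
    finally show ?thesis using F_bounds(1)[of t] by simp
  qed
  have "emeasure (density lborel (\<lambda>x :: real^'n. \<Prod>k\<in>UNIV. f (x $ k))) {..x} =
      emeasure (density lborel cube_density) {..(\<chi> k. F (x $ k))}"
    by (simp add: emeasure_product_density_atMost eq emeasure_margin)
  then show "measure (density lborel (\<lambda>x :: real^'n. \<Prod>k\<in>UNIV. f (x $ k))) {..x} =
      measure (density lborel cube_density) {..(\<chi> k. F (x $ k))}"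
    by (simp add: measure_def)
qed auto

lemma quantile_cart_eq:
  assumes "\<forall>k. 0 < u $ k \<and> u $ k < 1"
  shows "(\<chi> k. quantile (u $ k)) = (\<chi> k. Q (u $ k))" "(\<chi> k. F (quantile (u $ k))) = u"
  using assms by (auto simp: quantile_def F_Q vec_eq_iff)

end

text \<open>The law of \<open>U\<close> is the image of the spherical law under the marginal cdfs,
  since these undo the quantiles on the open cube. The representative \<open>h\<close> secures
  measurability: outside the cube \<open>marginal_quantile\<close> may be the infimum of a set that
  is empty or unbounded below.\<close>

lemma distr_meta_elliptical:
  fixes U :: "'a \<Rightarrow> real^'n"
  assumes dg: "density_generator CARD('n) g" and card: "2 \<le> CARD('n)"
    and U: "meta_elliptical M U (mat 1) g"
  obtains h where "h \<in> borel_measurable borel" "distr M borel U = density lborel h"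
    "\<And>u. \<forall>k. 0 < u $ k \<and> u $ k < 1 \<Longrightarrow> h u = meta_elliptical_density (mat 1) g u"
proof -
  interpret marginal_law "CARD('n)" g by (rule marginal_law_spherical) fact+
  let ?\<mu> = "distr M borel U" and ?P = "elliptical 0 (mat 1 :: real^'n^'n) g"
  let ?L = "density lborel (cube_density :: real^'n \<Rightarrow> ennreal)"
  let ?Q = "\<lambda>u :: real^'n. \<chi> k. quantile (u $ k)" and ?F = "\<lambda>x :: real^'n. \<chi> k. F (x $ k)"
  let ?f = "\<lambda>x :: real^'n. \<Prod>k\<in>UNIV. f (x $ k)"
  define r where "r x = g (x \<bullet> x) / ?f x" for x
  note [measurable] = borel_measurable_generator_comp[OF generator]
  have r [measurable]: "r \<in> borel_measurable borel" unfolding r_def by measurable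
  have F [measurable]: "?F \<in> borel_measurable borel"
    by (intro borel_measurable_vec_lambda) measurable
  have [measurable]: "(\<lambda>u :: real^'n. \<chi> k. F (quantile (u $ k))) \<in> borel_measurable borel"
    by (intro borel_measurable_vec_lambda) measurable
  have AE: "AE u in ?\<mu>. \<forall>k. 0 < u $ k \<and> u $ k < 1" and P: "?P = distr ?\<mu> borel ?Q"
    using meta_elliptical_distr_quantile[OF correlation_matrix_mat_1 dg card U] by auto
  \<comment> \<open>On \<open>Z\<close> division by a marginal density loses information. The margin
    gives \<open>Z\<close> mass zero, so \<open>g\<close> vanishes almost everywhere there, and
    multiplying \<open>r\<close> by the product of the margins recovers \<open>g\<close> almost
    everywhere.\<close>
  define Z where "Z = {t. f t = 0 \<or> f t = \<infinity>}"
  have [measurable]: "Z \<in> sets borel" unfolding Z_def by measurable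
  have "AE x in lborel. x $ k \<in> Z \<longrightarrow> g (x \<bullet> x) = 0" for k :: 'n
  proof -
    have "AE t in lborel. f t \<noteq> \<infinity>"
      using nn_integral_f by (intro nn_integral_PInf_AE) auto
    then have "(\<integral>\<^sup>+t. f t * indicator Z t \<partial>lborel) = (\<integral>\<^sup>+t. 0 \<partial>(lborel :: real measure))"
      by (intro nn_integral_cong_AE, eventually_elim) (auto simp: Z_def split: split_indicator)
    then have "emeasure (margin ?P k) Z = 0"
      unfolding margin_spherical[OF generator card] by (simp add: emeasure_density)
    moreover have "emeasure (margin ?P k) Z = emeasure ?P {x. x $ k \<in> Z}"
      by (simp add: margin_def elliptical_mat_1 emeasure_distr vimage_def)
    moreover have "{x :: real^'n. x $ k \<in> Z} \<in> sets borel" by measurable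
    ultimately have "(\<integral>\<^sup>+x. g (x \<bullet> x) * indicator {x. x $ k \<in> Z} x \<partial>lborel) = 0"
      by (simp add: elliptical_mat_1 emeasure_density)
    then show ?thesis
      by (subst (asm) nn_integral_0_iff_AE) (auto elim!: eventually_mono split: split_indicator_asm)
  qed
  then have "AE x in lborel. \<forall>k :: 'n. x $ k \<in> Z \<longrightarrow> g (x \<bullet> x) = 0"
    by (subst AE_all_countable) blast
  then have "AE x in lborel. g (x \<bullet> x) = ?f x * r x"
  proof eventually_elim
    case (elim x)
    show ?case
    proof (cases "\<exists>k. x $ k \<in> Z")
      case True
      then have "g (x \<bullet> x) = 0" using elim by auto
      then show ?thesis by (simp add: r_def)
    next
      case False
      then have "?f x \<noteq> 0" "?f x \<noteq> \<infinity>" by (auto simp: Z_def ennreal_prod_eq_top)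
      then show ?thesis by (simp add: r_def ennreal_times_divide ennreal_mult_divide_eq mult.commute[of "?f x"])
    qed
  qed
  then have "?P = density lborel (\<lambda>x. ?f x * r x)"
    unfolding elliptical_mat_1 by (intro density_cong) auto
  also have "\<dots> = density (density lborel ?f) r"
    by (subst density_density_eq) auto
  also have "\<dots> = density (distr ?L borel ?Q) r"
    unfolding product_margin_eq_distr_quantile ..
  also have "\<dots> = distr (density ?L (\<lambda>u. r (?Q u))) borel ?Q"
    by (subst density_distr) auto
  finally have P': "?P = distr (density ?L (\<lambda>u. r (?Q u))) borel ?Q" .
  have "?\<mu> = distr ?\<mu> borel (\<lambda>u. u)" by (simp add: distr_id2)
  also have "\<dots> = distr ?\<mu> borel (\<lambda>u. ?F (?Q u))"
  proof (rule distr_cong_AE)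
    show "AE u in ?\<mu>. u = ?F (?Q u)"
      using AE by eventually_elim (simp add: quantile_cart_eq(2))
  qed auto
  also have "\<dots> = distr ?P borel ?F"
    unfolding P by (subst distr_distr) (auto simp: o_def)
  also have "\<dots> = distr (density ?L (\<lambda>u. r (?Q u))) borel (\<lambda>u. ?F (?Q u))"
    unfolding P' by (subst distr_distr) (auto simp: o_def)
  also have "\<dots> = distr (density ?L (\<lambda>u. r (?Q u))) borel (\<lambda>u. u)"
  proof (rule distr_cong_AE)
    have "AE u in lborel. 0 < cube_density u * r (?Q u) \<longrightarrow> ?F (?Q u) = u"
      by (rule AE_I2) (auto simp: cube_density_eq quantile_cart_eq(2))
    then show "AE u in density ?L (\<lambda>u. r (?Q u)). ?F (?Q u) = u"
      by (subst density_density_eq) (auto simp: AE_density)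
  qed auto
  also have "\<dots> = density ?L (\<lambda>u. r (?Q u))" by (simp add: distr_id2)
  also have "\<dots> = density lborel (\<lambda>u. cube_density u * r (?Q u))"
    by (subst density_density_eq) auto
  finally have "?\<mu> = density lborel (\<lambda>u. cube_density u * r (?Q u))" .
  moreover have "cube_density u * r (?Q u) = meta_elliptical_density (mat 1) g u"
    if "\<forall>k. 0 < u $ k \<and> u $ k < 1" for u
    using that by (simp add: cube_density_eq r_def meta_elliptical_density_def quantile_vec_def
        quantile_cart_eq(1) matrix_inv_mat_1 quantile_def)
  ultimately show ?thesis by (intro that[of "\<lambda>u. cube_density u * r (?Q u)"]) auto
qed

lemma AE_meta_elliptical_density_eq:
  fixes U :: "'a \<Rightarrow> real^'n"
  assumes card: "2 \<le> CARD('n)"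
    and dg: "density_generator CARD('n) g" and U: "meta_elliptical M U (mat 1) g"
    and dg1: "density_generator CARD('n) g1" and U1: "meta_elliptical M U (mat 1) g1"
  shows "AE u in (lborel :: (real^'n) measure). (\<forall>k. 0 < u $ k \<and> u $ k < 1) \<longrightarrow>
    meta_elliptical_density (mat 1) g u = meta_elliptical_density (mat 1) g1 u"
proof -
  obtain h where h: "h \<in> borel_measurable borel" "distr M borel U = density lborel h"
    "\<And>u. \<forall>k. 0 < u $ k \<and> u $ k < 1 \<Longrightarrow> h u = meta_elliptical_density (mat 1) g u"
    using distr_meta_elliptical[OF dg card U] by metis
  obtain h1 where h1: "h1 \<in> borel_measurable borel" "distr M borel U = density lborel h1"
    "\<And>u. \<forall>k. 0 < u $ k \<and> u $ k < 1 \<Longrightarrow> h1 u = meta_elliptical_density (mat 1) g1 u"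
    using distr_meta_elliptical[OF dg1 card U1] by metis
  have "AE u in lborel. h u = h1 u"
    using h h1 by (intro sigma_finite_measure.density_unique[OF sigma_finite_lborel]) auto
  then show ?thesis by eventually_elim (metis h(3) h1(3))
qed

section \<open>Recovering the density on a slice\<close>

text \<open>A point of disagreement would have an open neighbourhood of disagreement, which has
  positive measure. This turns equalities of densities into pointwise ones.\<close>

lemma AE_lborel_eq_imp_eq:
  fixes f g :: "'a::euclidean_space \<Rightarrow> real"
  assumes S: "open S" and f: "continuous_on S f" and g: "continuous_on S g"
    and AE: "AE x in lborel. x \<in> S \<longrightarrow> f x = g x" and x: "x \<in> S"
  shows "f x = g x"
proof (rule ccontr)
  assume neq: "f x \<noteq> g x"
  let ?T = "S \<inter> (\<lambda>x. f x - g x) -` (- {0})"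
  have T: "open ?T"
    using S f g by (intro continuous_open_preimage continuous_on_diff) auto
  have "AE x in lborel. x \<notin> ?T" using AE by eventually_elim auto
  then have "emeasure lborel ?T = 0"
    using T by (subst (asm) AE_iff_measurable[of ?T]) auto
  then show False using emeasure_lborel_open_pos[OF T, of x] x neq by auto
qed

text \<open>For each \<open>t\<close>, translation invariance keeps the exceptional set null, and
  Fubini exchanges \<open>t\<close> with \<open>x\<close>. Single lines are null in dimension above
  one, so only almost every base point is obtained.\<close>

lemma AE_lborel_line:
  fixes e :: "'a::euclidean_space"
  assumes "AE x in lborel. P x"
  shows "AE x in lborel. AE t in (lborel :: real measure). P (x + t *\<^sub>R e)"
proof -
  have pair: "pair_sigma_finite (lborel :: 'a measure) (lborel :: real measure)" ..
  \<comment> \<open>A measurable null superset is taken because \<open>P\<close> itself may fail to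
    be measurable.\<close>
  obtain N where N: "{x. \<not> P x} \<subseteq> N" "N \<in> null_sets lborel"
    using assms by (auto simp: eventually_ae_filter)
  then have [measurable]: "N \<in> sets borel" by auto
  have "AE x in lborel. x + t *\<^sub>R e \<notin> N" for t
  proof -
    have "AE x in distr lborel borel ((+) (t *\<^sub>R e)). x \<notin> N"
      unfolding lborel_distr_plus using N(2) by (rule AE_not_in)
    then show ?thesis by (subst (asm) AE_distr_iff) (auto simp: add.commute)
  qed
  then have "AE t in (lborel :: real measure). AE x in lborel. x + t *\<^sub>R e \<notin> N" by simp
  moreover have "(\<lambda>z. fst z + snd z *\<^sub>R e) -` (- N) \<inter> space (lborel \<Otimes>\<^sub>M (lborel :: real measure)) \<in> sets (lborel \<Otimes>\<^sub>M lborel)"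
    by (rule measurable_sets[where A = borel]) auto
  then have "{z \<in> space (lborel \<Otimes>\<^sub>M (lborel :: real measure)). fst z + snd z *\<^sub>R e \<notin> N} \<in> sets (lborel \<Otimes>\<^sub>M lborel)"
    by (auto simp: vimage_def Int_def conj_commute)
  ultimately have "AE x in lborel. AE t in (lborel :: real measure). x + t *\<^sub>R e \<notin> N"
    using pair_sigma_finite.AE_commute[OF pair, of "\<lambda>x t. x + t *\<^sub>R e \<notin> N"] by blast
  then show ?thesis
    by eventually_elim (use N(1) in \<open>auto elim!: eventually_mono\<close>)
qed

section \<open>Strict monotonicity of the marginal cdf and continuity of the quantile
  function\<close>

lemma marginal_constant_pos: "2 \<le> d \<Longrightarrow> 0 < pi powr ((real d - 1) / 2) / Gamma ((real d - 1) / 2)"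
  by (intro divide_pos_pos Gamma_real_pos) auto

lemma marginal_density_eq_0_iff:
  fixes g :: "real \<Rightarrow> ennreal"
  assumes g: "g \<in> borel_measurable (restrict_space borel {0..})" and "2 \<le> d"
  shows "marginal_density d g t = 0 \<longleftrightarrow> (AE s in lborel. 0 < s \<longrightarrow> g (t\<^sup>2 + s) = 0)"
proof -
  note [measurable] = borel_measurable_generator_abs[OF g]
  have eq: "(\<integral>\<^sup>+s\<in>{0<..}. g (t\<^sup>2 + s) * ennreal (s powr ((real d - 3) / 2)) \<partial>lborel) =
      (\<integral>\<^sup>+s\<in>{0<..}. g \<bar>t\<^sup>2 + s\<bar> * ennreal (s powr ((real d - 3) / 2)) \<partial>lborel)"
    by (intro nn_integral_cong) (auto split: split_indicator)
  have "marginal_density d g t = 0 \<longleftrightarrow>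
      (\<integral>\<^sup>+s\<in>{0<..}. g \<bar>t\<^sup>2 + s\<bar> * ennreal (s powr ((real d - 3) / 2)) \<partial>lborel) = 0"
    unfolding marginal_density_def eq mult_eq_0_iff ennreal_eq_0_iff
    using marginal_constant_pos[OF \<open>2 \<le> d\<close>] by (simp only: not_le[symmetric] simp_thms)
  also have "\<dots> \<longleftrightarrow> (AE s in lborel. g \<bar>t\<^sup>2 + s\<bar> * ennreal (s powr ((real d - 3) / 2)) * indicator {0<..} s = 0)"
    by (intro nn_integral_0_iff_AE) auto
  also have "\<dots> \<longleftrightarrow> (AE s in lborel. 0 < s \<longrightarrow> g (t\<^sup>2 + s) = 0)"
    by (intro AE_cong) (auto split: split_indicator)
  finally show ?thesis .
qed

text \<open>A zero of the marginal density at \<open>t\<close> forces \<open>g\<close> to vanish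
  almost everywhere beyond t^2, hence beyond every larger square.\<close>

lemma marginal_density_eq_0_mono:
  fixes g :: "real \<Rightarrow> ennreal"
  assumes g: "g \<in> borel_measurable (restrict_space borel {0..})" and "2 \<le> d"
    and 0: "marginal_density d g t = 0" and le: "\<bar>t\<bar> \<le> \<bar>t'\<bar>"
  shows "marginal_density d g t' = 0"
proof -
  note [measurable] = borel_measurable_generator_abs[OF g]
  have \<delta>: "0 \<le> t'\<^sup>2 - t\<^sup>2" using le by (simp add: abs_le_square_iff)
  have "AE s in lborel. 0 < s \<longrightarrow> g (t\<^sup>2 + s) = 0"
    using 0 marginal_density_eq_0_iff[OF g \<open>2 \<le> d\<close>] by blast
  then have "AE s in lborel. 0 < s \<longrightarrow> g \<bar>t\<^sup>2 + s\<bar> = 0" by eventually_elim auto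
  then have "AE s in lborel. 0 < (t'\<^sup>2 - t\<^sup>2) + 1 * s \<longrightarrow> g \<bar>t\<^sup>2 + ((t'\<^sup>2 - t\<^sup>2) + 1 * s)\<bar> = 0"
    by (rule AE_borel_affine[where P = "\<lambda>s. 0 < s \<longrightarrow> g \<bar>t\<^sup>2 + s\<bar> = 0", rotated 2]) (simp, measurable)
  then have "AE s in lborel. 0 < s \<longrightarrow> g (t'\<^sup>2 + s) = 0"
    by eventually_elim (use \<delta> in auto)
  then show ?thesis using marginal_density_eq_0_iff[OF g \<open>2 \<le> d\<close>] by blast
qed

context marginal_law
begin

lemma F_strict:
  assumes d: "2 \<le> d" and "x < y" "0 < F x" "F y < 1"
  shows "F x < F y"
proof (rule ccontr)
  assume "\<not> F x < F y"
  then have eq: "F x = F y" using mono_F[of x y] assms by simp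
  have "measure (density lborel f) {x<..y} = 0"
    using N.cdf_diff_eq[of x y] assms eq by (simp add: cdf_margin)
  then have "(\<integral>\<^sup>+t. f t * indicator {x<..y} t \<partial>lborel) = 0"
    using N.emeasure_eq_measure[of "{x<..y}"] by (simp add: emeasure_density)
  then have AE: "AE t in lborel. t \<in> {x<..y} \<longrightarrow> f t = 0"
    by (subst (asm) nn_integral_0_iff_AE) (auto elim!: eventually_mono split: split_indicator_asm)
  obtain t where t: "x < t" "t < y" "t \<noteq> 0" "f t = 0"
  proof (rule ccontr)
    assume "\<not> thesis"
    then have nz: "\<forall>t. x < t \<and> t < y \<and> t \<noteq> 0 \<longrightarrow> f t \<noteq> 0" using that by blast
    have "AE t in lborel. t \<notin> {x<..<y}"
      using AE AE_lborel_singleton[of "0 :: real"] by eventually_elim (use nz in auto)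
    then have "emeasure lborel {x<..<y} = 0"
      by (subst (asm) AE_iff_measurable[of "{x<..<y}"]) auto
    then show False using \<open>x < y\<close> by simp
  qed
  have 1: "F s = 1" if "0 < s" "f s = 0" for s
  proof -
    have "emeasure (density lborel f) {s<..} = (\<integral>\<^sup>+t. f t * indicator {s<..} t \<partial>lborel)"
      by (simp add: emeasure_density)
    also have "\<dots> = (\<integral>\<^sup>+t. 0 \<partial>(lborel :: real measure))"
      using that by (intro nn_integral_cong)
        (auto split: split_indicator intro!: marginal_density_eq_0_mono[OF generator d, of s])
    finally have "measure (density lborel f) (space (density lborel f) - {..s}) = 0"
      by (simp add: measure_def Compl_eq_Diff_UNIV[symmetric])
    then show ?thesis
      using N.prob_compl[of "{..s}"] by (simp add: cdf_margin[symmetric] cdf_def)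
  qed
  show False
  proof (cases "0 < t")
    case True
    then have "F t = 1" using t 1 by blast
    then show False using mono_F[of t y] t assms by simp
  next
    case False
    then have "F (- t) = 1" using t 1[of "- t"] by (simp add: marginal_density_minus)
    then have "F t = 0" using F_minus[of t] by simp
    then show False using mono_F[of x t] t assms by simp
  qed
qed

lemma Q_F: assumes "2 \<le> d" "0 < F x" "F x < 1" shows "Q (F x) = x"
proof (rule antisym)
  show "Q (F x) \<le> x" using assms by (simp add: Q_le_iff)
  show "x \<le> Q (F x)"
  proof (rule ccontr)
    assume "\<not> x \<le> Q (F x)"
    then show False
      using F_strict[OF \<open>2 \<le> d\<close>, of "Q (F x)" x] F_Q[of "F x"] assms by simp
  qed
qed

lemma Q_half: "2 \<le> d \<Longrightarrow> Q (1 / 2) = 0"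
  using Q_F[of 0] by (simp add: F_0)

lemma Q_nonneg: assumes "2 \<le> d" "1 / 2 \<le> u" "u < 1" shows "0 \<le> Q u"
proof (rule ccontr)
  assume neg: "\<not> 0 \<le> Q u"
  then have "u = 1 / 2" using mono_F[of "Q u" 0] F_Q[of u] F_0 assms by simp
  then show False using Q_half[OF assms(1)] neg by (metis order_refl)
qed

text \<open>A jump of \<open>Q\<close> would be a flat piece of \<open>F\<close> at a level strictly
  between 0 and 1.\<close>

lemma isCont_Q: assumes d: "2 \<le> d" and u: "0 < u" "u < 1" shows "isCont Q u"
  unfolding isCont_def
proof (rule tendstoI)
  fix e :: real assume e: "0 < e"
  have "\<not> Q u \<le> Q u - e / 2" using e by simp
  then have 1: "F (Q u - e / 2) < u" using Q_le_iff[OF u] by simp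
  have 2: "u < F (Q u + e / 2)"
  proof (rule ccontr)
    assume "\<not> u < F (Q u + e / 2)"
    then show False
      using F_strict[OF d, of "Q u" "Q u + e / 2"] F_Q[OF u] e u by simp
  qed
  have "eventually (\<lambda>v. v \<in> {max 0 (F (Q u - e / 2))<..<min 1 (F (Q u + e / 2))}) (nhds u)"
    using 1 2 u by (intro eventually_nhds_in_open) auto
  then have "eventually (\<lambda>v. dist (Q v) (Q u) < e) (nhds u)"
  proof eventually_elim
    case (elim v)
    then have "\<not> Q v \<le> Q u - e / 2" "Q v \<le> Q u + e / 2"
      by (auto simp: Q_le_iff)
    then show ?case using e by (auto simp: dist_real_def)
  qed
  then show "eventually (\<lambda>v. dist (Q v) (Q u) < e) (at u)"
    by (simp add: eventually_at_filter eventually_mono)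
qed

end

section \<open>Evaluation on the slice and its recovery from lines in the cube\<close>

lemma sum_slice_point:
  fixes i j :: "'n::finite"
  assumes "i \<noteq> j"
  shows "(\<Sum>k\<in>UNIV. \<phi> (slice_point i j u v $ k)) = \<phi> u + \<phi> v + (\<Sum>k\<in>UNIV - {i, j}. \<phi> (1 / 2) :: real)"
proof -
  have "(\<Sum>k\<in>UNIV. \<phi> (slice_point i j u v $ k)) = \<phi> u + (\<phi> v + (\<Sum>k\<in>UNIV - {i} - {j}. \<phi> (slice_point i j u v $ k)))"
    using assms by (simp add: sum.remove[of UNIV i] sum.remove[of "UNIV - {i}" j] slice_point_def)
  also have "(\<Sum>k\<in>UNIV - {i} - {j}. \<phi> (slice_point i j u v $ k)) = (\<Sum>k\<in>UNIV - {i, j}. \<phi> (1 / 2))"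
    by (intro sum.cong) (auto simp: slice_point_def)
  finally show ?thesis by (simp add: add.assoc)
qed

lemma prod_slice_point:
  fixes i j :: "'n::finite" and \<phi> :: "real \<Rightarrow> 'a::comm_monoid_mult"
  assumes "i \<noteq> j"
  shows "(\<Prod>k\<in>UNIV. \<phi> (slice_point i j u v $ k)) = \<phi> u * \<phi> v * (\<Prod>k\<in>UNIV - {i, j}. \<phi> (1 / 2))"
proof -
  have "(\<Prod>k\<in>UNIV. \<phi> (slice_point i j u v $ k)) = \<phi> u * (\<phi> v * (\<Prod>k\<in>UNIV - {i} - {j}. \<phi> (slice_point i j u v $ k)))"
    using assms by (simp add: prod.remove[of UNIV i] prod.remove[of "UNIV - {i}" j] slice_point_def)
  also have "(\<Prod>k\<in>UNIV - {i} - {j}. \<phi> (slice_point i j u v $ k)) = (\<Prod>k\<in>UNIV - {i, j}. \<phi> (1 / 2))"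
    by (intro prod.cong) (auto simp: slice_point_def)
  finally show ?thesis by (simp add: mult.assoc)
qed

lemma meta_elliptical_density_mat_1:
  fixes u :: "real^'n"
  shows "meta_elliptical_density (mat 1) g u = g (\<Sum>k\<in>UNIV. (marginal_quantile CARD('n) g (u $ k))\<^sup>2) /
    (\<Prod>k\<in>UNIV. marginal_density CARD('n) g (marginal_quantile CARD('n) g (u $ k)))"
  by (simp add: meta_elliptical_density_def matrix_inv_mat_1 quantile_vec_def inner_vec_def power2_eq_square)

lemma ennreal_divide_pos_finite:
  fixes a b :: ennreal
  assumes "0 < a / b" "a / b < \<infinity>"
  shows "0 < a" "a < \<infinity>" "0 < b" "b < \<infinity>"
proof -
  have nz: "a * inverse b \<noteq> 0" "a * inverse b \<noteq> \<infinity>"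
    using assms by (auto simp: divide_ennreal_def)
  then show "0 < a" "b < \<infinity>" by (auto simp: zero_less_iff_neq_zero less_top)
  then show "0 < b" using nz by (auto simp: zero_less_iff_neq_zero ennreal_mult_eq_top_iff)
  show "a < \<infinity>" using nz by (auto simp: less_top ennreal_mult_eq_top_iff)
qed

lemma enn2real_divide_ennreal:
  assumes "0 < p"
  shows "enn2real (a / ennreal p) = enn2real a / p"
  using assms by (cases a) (auto simp: divide_ennreal ennreal_top_divide)

lemma open_cube: "open {w :: real^'n. \<forall>k. 0 < w $ k \<and> w $ k < 1}"
proof -
  have "{w :: real^'n. \<forall>k. 0 < w $ k \<and> w $ k < 1} = box (\<chi> k. 0) (\<chi> k. 1)"
    by (auto simp: mem_box_cart)
  then show ?thesis using open_box by metis
qed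

text \<open>
  For a merely measurable \<open>g\<close> the slice is a null set if \<open>d > 2\<close>, so the almost everywhere
  identity says nothing about it directly. However, \<open>g\<close> only sees
  \<open>Q(w\<^sub>i)\<^sup>2 + (\<Sum>k\<noteq>i. Q(w\<^sub>k)\<^sup>2)\<close>: the values of the density along the line through \<open>w\<close> in direction
  \<open>i\<close> are those of \<open>c\<close> on a line \<open>v = V w\<close>, up to a factor that does not depend on \<open>w\<^sub>i\<close>.
  This factor drops out of the cross ratios, which are continuous in \<open>w\<close>.
\<close>

lemma slice_density_ratio:
  fixes g :: "real \<Rightarrow> ennreal" and K :: "real^'n \<Rightarrow> real" and i j :: 'n
  defines "cube \<equiv> {w :: real^'n. \<forall>k. 0 < w $ k \<and> w $ k < 1}"
  assumes card: "2 \<le> CARD('n)" and dg: "density_generator CARD('n) g" and ij: "i \<noteq> j"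
    and cdef: "\<And>u v. c u v = meta_elliptical_density (mat 1) g (slice_point i j u v)"
    and cpos: "\<And>u v. 0 < u \<Longrightarrow> u < 1 \<Longrightarrow> 0 < v \<Longrightarrow> v < 1 \<Longrightarrow> 0 < c u v \<and> c u v < \<infinity>"
    and ccont: "\<And>u v. 0 < u \<Longrightarrow> u < 1 \<Longrightarrow> 0 < v \<Longrightarrow> v < 1 \<Longrightarrow> isCont (\<lambda>x. enn2real (c x v)) u"
    and Kc: "continuous_on cube K"
    and AE: "AE w in lborel. w \<in> cube \<longrightarrow> enn2real (meta_elliptical_density (mat 1) g w) = K w"
    and x: "0 < x" "x < 1" and x': "0 < x'" "x' < 1" and v: "1 / 2 < v" "v < 1"
  shows "enn2real (c x v) * K (slice_point i j x' v) = enn2real (c x' v) * K (slice_point i j x v)"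
proof -
  interpret marginal_law "CARD('n)" g by (rule marginal_law_spherical) fact+
  define S where "S u v = enn2real (c u v)" for u v
  define h where "h u = enn2real (f (Q u))" for u
  define G where "G s = enn2real (g s)" for s
  define m where "m w = enn2real (meta_elliptical_density (mat 1) g w)" for w :: "real^'n"
  have cube: "open cube" unfolding cube_def by (rule open_cube)
  \<comment> \<open>The slice point with both arguments \<open>u\<close> suffices: a zero or
    infinite marginal factor there is incompatible with a quotient strictly between 0 and
    \<infinity>.\<close>
  have hpos: "0 < h u" "f (Q u) = ennreal (h u)" if u: "0 < u" "u < 1" for u
  proof -
    have "0 < c u u \<and> c u u < \<infinity>" using cpos u by blast
    then have "(\<Prod>k\<in>UNIV. f (Q (slice_point i j u u $ k))) \<noteq> 0" "(\<Prod>k\<in>UNIV. f (Q (slice_point i j u u $ k))) \<noteq> \<infinity>"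
      unfolding cdef meta_elliptical_density_mat_1
      using ennreal_divide_pos_finite(3,4) by (metis less_irrefl)+
    then have "f (Q (slice_point i j u u $ i)) \<noteq> 0" "f (Q (slice_point i j u u $ i)) \<noteq> \<infinity>"
      by (auto simp: ennreal_prod_eq_top)
    then have *: "f (Q u) \<noteq> 0" "f (Q u) \<noteq> \<infinity>" by (auto simp: slice_point_def)
    then show "0 < h u" "f (Q u) = ennreal (h u)"
      by (auto simp: h_def enn2real_positive_iff less_top zero_less_iff_neq_zero)
  qed
  have m: "m w = G (\<Sum>k\<in>UNIV. (Q (w $ k))\<^sup>2) / (\<Prod>k\<in>UNIV. h (w $ k))" if "w \<in> cube" for w
  proof -
    have w: "0 < w $ k" "w $ k < 1" for k using that by (auto simp: cube_def)
    have "(\<Prod>k\<in>UNIV. f (Q (w $ k))) = ennreal (\<Prod>k\<in>UNIV. h (w $ k))"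
      using hpos w by (subst prod_ennreal[symmetric]) (auto intro: less_imp_le)
    moreover have "0 < (\<Prod>k\<in>UNIV. h (w $ k))" using hpos w by (intro prod_pos) auto
    ultimately show ?thesis
      unfolding m_def meta_elliptical_density_mat_1 by (simp add: enn2real_divide_ennreal G_def)
  qed
  define B where "B v = h v * (\<Prod>k\<in>UNIV - {i, j}. h (1 / 2))" for v
  have Bpos: "0 < B v" if "0 < v" "v < 1" for v
    unfolding B_def using hpos that by (intro mult_pos_pos prod_pos) auto
  have slice_cube: "slice_point i j u v \<in> cube" if "0 < u" "u < 1" "0 < v" "v < 1" for u v
    using that by (auto simp: cube_def slice_point_def)
  have S: "S u v = G ((Q u)\<^sup>2 + (Q v)\<^sup>2) / (h u * B v)" if "0 < u" "u < 1" "0 < v" "v < 1" for u v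
    using m[OF slice_cube[OF that]] Q_half[OF card]
    by (simp add: S_def cdef m_def sum_slice_point[OF ij, where \<phi> = "\<lambda>t. (Q t)\<^sup>2"]
        prod_slice_point[OF ij, where \<phi> = h] B_def mult_ac)
  \<comment> \<open>Continuity is available in the first argument; the symmetry of the spherical
    density supplies it in the second, along which \<open>V w\<close> varies.\<close>
  have Ssym: "S u v = S v u" for u v
    by (simp add: S_def cdef meta_elliptical_density_mat_1 add_ac mult_ac
        sum_slice_point[OF ij, where \<phi> = "\<lambda>t. (Q t)\<^sup>2"]
        prod_slice_point[OF ij, where \<phi> = "\<lambda>t. f (Q t)"])
  have S1: "isCont (\<lambda>x. S x v) u" if "0 < u" "u < 1" "0 < v" "v < 1" for u v
    unfolding S_def by (rule ccont) (fact that)+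
  have S2: "isCont (\<lambda>x. S v x) u" if "0 < u" "u < 1" "0 < v" "v < 1" for u v
  proof -
    have "(\<lambda>x. S v x) = (\<lambda>x. S x v)" by (rule ext) (rule Ssym)
    then show ?thesis using S1[OF that] by simp
  qed

  \<comment> \<open>\<open>y w\<close> is the norm of the quantiles of all coordinates other than
    \<open>i\<close>, and \<open>V w\<close> is the level at which coordinate \<open>j\<close> alone
    would have this quantile.\<close>
  define y where "y w = sqrt (\<Sum>k\<in>UNIV - {i}. (Q (w $ k))\<^sup>2)" for w :: "real^'n"
  define V where "V w = F (y w)" for w
  define A where "A w = (\<Prod>k\<in>UNIV - {i}. h (w $ k))" for w :: "real^'n"
  \<comment> \<open>On this open set the level \<open>V w\<close> stays inside (0,1), so that
    \<open>Q (V w) = y w\<close>.\<close>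
  define D where "D = {w \<in> cube. V w < 1}"
  have ycont: "continuous_on cube y"
  proof -
    have "continuous_on cube (\<lambda>w. Q (w $ k))" for k
    proof (rule continuous_on_compose2[of "{0<..<1}" Q])
      show "continuous_on {0<..<1} Q"
        using isCont_Q[OF card] by (intro continuous_at_imp_continuous_on) auto
    qed (auto simp: cube_def intro!: continuous_intros)
    then show ?thesis unfolding y_def by (intro continuous_intros)
  qed
  have Vcont: "continuous_on cube V"
    unfolding V_def
  proof (rule continuous_on_compose2[of UNIV F])
    show "continuous_on UNIV F" using isCont_F by (intro continuous_at_imp_continuous_on) auto
  qed (use ycont in auto)
  have "D = cube \<inter> V -` {..<1}" by (auto simp: D_def)
  then have D: "open D" using continuous_open_preimage[OF Vcont cube] by simp
  have V: "0 < V w" "V w < 1" "Q (V w) = y w" if "w \<in> D" for w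
  proof -
    have "0 \<le> y w" unfolding y_def by (intro real_sqrt_ge_zero sum_nonneg) auto
    then have "1 / 2 \<le> V w" using mono_F[of 0 "y w"] by (simp add: V_def F_0)
    then show 1: "0 < V w" "V w < 1" using that by (auto simp: D_def)
    then show "Q (V w) = y w" unfolding V_def by (intro Q_F[OF card])
  qed
  define upd where "upd w t = (\<chi> k. if k = i then t else w $ k)" for w :: "real^'n" and t
  have upd_cube: "upd w t \<in> cube" if "w \<in> cube" "0 < t" "t < 1" for w t
    using that by (auto simp: cube_def upd_def)
  have m_upd: "m (upd w t) = S t (V w) * (B (V w) / A w)" if w: "w \<in> D" and t: "0 < t" "t < 1" for w t
  proof -
    have wc: "w \<in> cube" using w by (simp add: D_def)
    have sq: "(y w)\<^sup>2 = (\<Sum>k\<in>UNIV - {i}. (Q (w $ k))\<^sup>2)"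
      unfolding y_def by (intro real_sqrt_pow2 sum_nonneg) auto
    have "(\<Sum>k\<in>UNIV. (Q (upd w t $ k))\<^sup>2) = (Q t)\<^sup>2 + (y w)\<^sup>2"
      unfolding sq by (subst sum.remove[of _ i]) (auto simp: upd_def)
    moreover have "(\<Prod>k\<in>UNIV. h (upd w t $ k)) = h t * A w"
      unfolding A_def by (subst prod.remove[of _ i]) (auto simp: upd_def)
    ultimately show ?thesis
      using m[OF upd_cube[OF wc t]] S[OF t V(1,2)[OF w]] V(3)[OF w] Bpos[OF V(1,2)[OF w]] by simp
  qed

  have "AE w in lborel. AE t in (lborel :: real measure). w + t *\<^sub>R axis i 1 \<in> cube \<longrightarrow>
      m (w + t *\<^sub>R axis i 1) = K (w + t *\<^sub>R axis i 1)"
    using AE unfolding m_def by (rule AE_lborel_line)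
  \<comment> \<open>The cross products cancel the factor \<open>B (V w) / A w\<close>, for which no
    continuity is established. What remains is continuous in \<open>w\<close>.\<close>
  then have AE_D: "AE w in lborel. w \<in> D \<longrightarrow> S x (V w) * K (upd w x') = S x' (V w) * K (upd w x)"
  proof eventually_elim
    case (elim w)
    show ?case
    proof
      assume w: "w \<in> D"
      then have wc: "w \<in> cube" by (simp add: D_def)
      let ?T = "{- (w $ i)<..<1 - w $ i}"
      have upd: "w + t *\<^sub>R axis i 1 = upd w (w $ i + t)" for t
        by (auto simp: upd_def vec_eq_iff axis_def)
      have eq: "S s (V w) * (B (V w) / A w) = K (upd w s)" if s: "0 < s" "s < 1" for s
      proof -
        \<comment> \<open>Along one line \<open>V w\<close> and the factor are constant, so both
          sides are continuous in \<open>t\<close> and the almost everywhere identity holds at every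
          point of the line.\<close>
        have "S (w $ i + t) (V w) * (B (V w) / A w) = K (w + t *\<^sub>R axis i 1)" if "t \<in> ?T" for t
        proof (rule AE_lborel_eq_imp_eq[where S = ?T and x = t
              and f = "\<lambda>t. S (w $ i + t) (V w) * (B (V w) / A w)" and g = "\<lambda>t. K (w + t *\<^sub>R axis i 1)"])
          show "continuous_on ?T (\<lambda>t. S (w $ i + t) (V w) * (B (V w) / A w))"
          proof (rule continuous_on_mult_right, rule continuous_on_compose2[of "{0<..<1}" "\<lambda>s. S s (V w)"])
            show "continuous_on {0<..<1} (\<lambda>s. S s (V w))"
              using S1 V[OF w] by (intro continuous_at_imp_continuous_on) auto
          qed (auto intro!: continuous_intros)
          show "continuous_on ?T (\<lambda>t. K (w + t *\<^sub>R axis i 1))"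
          proof (rule continuous_on_compose2[OF Kc])
            show "(\<lambda>t. w + t *\<^sub>R axis i 1) ` ?T \<subseteq> cube"
              unfolding upd using upd_cube[OF wc] by auto
          qed (intro continuous_intros)
          show "AE t in lborel. t \<in> ?T \<longrightarrow> S (w $ i + t) (V w) * (B (V w) / A w) = K (w + t *\<^sub>R axis i 1)"
            using elim
          proof eventually_elim
            case (elim t)
            show ?case
            proof
              assume "t \<in> ?T"
              then have t: "0 < w $ i + t" "w $ i + t < 1" by auto
              show "S (w $ i + t) (V w) * (B (V w) / A w) = K (w + t *\<^sub>R axis i 1)"
                using elim m_upd[OF w t] upd_cube[OF wc t] unfolding upd by simp
            qed
          qed
        qed (use that in auto)
        from this[of "s - w $ i"] show ?thesis using s by (simp add: upd)
      qed
      show "S x (V w) * K (upd w x') = S x' (V w) * K (upd w x)"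
        unfolding eq[OF x, symmetric] eq[OF x', symmetric] by simp
    qed
  qed
  \<comment> \<open>At the slice point the coordinates equal to 1/2 have quantile 0, so
    \<open>y w0\<close> is the absolute value of \<open>Q v\<close>. It equals \<open>Q v\<close>
    because v > 1/2.\<close>
  define w0 where "w0 = slice_point i j x v"
  have v': "0 < v" using v by simp
  have w0: "y w0 = Q v"
  proof -
    have "(\<Sum>k\<in>UNIV - {i}. (Q (w0 $ k))\<^sup>2) = (Q v)\<^sup>2 + (\<Sum>k\<in>UNIV - {i} - {j}. (Q (w0 $ k))\<^sup>2)"
      using ij by (subst sum.remove[of _ j]) (auto simp: w0_def slice_point_def)
    also have "(\<Sum>k\<in>UNIV - {i} - {j}. (Q (w0 $ k))\<^sup>2) = 0"
      using Q_half[OF card] by (intro sum.neutral) (auto simp: w0_def slice_point_def)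
    finally show ?thesis using Q_nonneg[OF card, of v] v by (simp add: y_def)
  qed
  have Vw0: "V w0 = v" using w0 F_Q[of v] v by (simp add: V_def)
  have "w0 \<in> D" using slice_cube[of x v] x v Vw0 by (simp add: D_def w0_def)
  have upd0: "upd w0 t = slice_point i j t v" for t
    by (auto simp: upd_def w0_def slice_point_def vec_eq_iff)
  have SV: "continuous_on D (\<lambda>w. S s (V w))" if "0 < s" "s < 1" for s
  proof (rule continuous_on_compose2[of "{0<..<1}" "\<lambda>t. S s t"])
    show "continuous_on {0<..<1} (\<lambda>t. S s t)"
      using S2 that by (intro continuous_at_imp_continuous_on) auto
    show "continuous_on D V" by (rule continuous_on_subset[OF Vcont]) (auto simp: D_def)
  qed (use V in auto)
  have KU: "continuous_on D (\<lambda>w. K (upd w s))" if "0 < s" "s < 1" for s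
  proof (rule continuous_on_compose2[OF Kc])
    show "continuous_on D (\<lambda>w. upd w s)"
      unfolding upd_def
    proof (rule continuous_on_vec_lambda)
      show "continuous_on D (\<lambda>w. if k = i then s else w $ k)" for k
        by (cases "k = i") (simp_all add: continuous_on_component)
    qed
  qed (use that upd_cube in \<open>auto simp: D_def\<close>)
  have "S x (V w0) * K (upd w0 x') = S x' (V w0) * K (upd w0 x)"
    using AE_D \<open>w0 \<in> D\<close> x x'
    by (intro AE_lborel_eq_imp_eq[OF D, where x = w0 and f = "\<lambda>w. S x (V w) * K (upd w x')"] continuous_intros SV KU) auto
  then show ?thesis by (simp add: Vw0 upd0 S_def)
qed

section \<open>Regular generators and the differential equation of the margin\<close>

text \<open>Each side of \<open>eq\<close> is the derivative of X(F) + ln \<phi>, and \<phi>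
  exp(X(F)) is the derivative of E(F). The equation is thus integrated explicitly twice; continuity
  of \<open>chi\<close> supplies the antiderivative X.\<close>

lemma second_order_ode_unique:
  fixes F1 F2 \<phi>1 \<phi>2 chi :: "real \<Rightarrow> real"
  assumes F1: "\<And>x. (F1 has_real_derivative \<phi>1 x) (at x)" "\<And>x. 0 < F1 x" "\<And>x. F1 x < 1"
    and F2: "\<And>x. (F2 has_real_derivative \<phi>2 x) (at x)" "\<And>x. 0 < F2 x" "\<And>x. F2 x < 1"
    and \<phi>1: "\<And>x. (\<phi>1 has_real_derivative \<phi>1' x) (at x)" "\<And>x. 0 < \<phi>1 x"
    and \<phi>2: "\<And>x. (\<phi>2 has_real_derivative \<phi>2' x) (at x)" "\<And>x. 0 < \<phi>2 x"
    and init: "F1 0 = F2 0" "\<phi>1 0 = \<phi>2 0"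
    and chi: "continuous_on {0<..<1} chi"
    and eq: "\<And>x. chi (F1 x) * \<phi>1 x + \<phi>1' x / \<phi>1 x = chi (F2 x) * \<phi>2 x + \<phi>2' x / \<phi>2 x"
  shows "F1 x = F2 x"
proof -
  have mono: "F1 y < F1 z" "F2 y < F2 z" if "y < z" for y z
    using DERIV_pos_imp_increasing[OF that, of F1] DERIV_pos_imp_increasing[OF that, of F2] F1(1) F2(1) \<phi>1(2) \<phi>2(2)
    by blast+
  \<comment> \<open>\<open>chi\<close> is controlled only inside (0,1), so antiderivatives are taken
    on [a, b], which contains the values of both cdfs over [-R, R]. This \<open>R\<close> puts
    \<open>x\<close> and the initial point 0 in the interior.\<close>
  define R where "R = \<bar>x\<bar> + 1"
  let ?S = "{- R<..<R}"
  define a where "a = min (F1 (- R)) (F2 (- R))"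
  define b where "b = max (F1 R) (F2 R)"
  have ab: "0 < a" "b < 1" using F1 F2 by (auto simp: a_def b_def)
  have F_ab: "F1 y \<in> {a<..<b}" "F2 y \<in> {a<..<b}" if "y \<in> ?S" for y
    using mono[of "- R" y] mono[of y R] that by (auto simp: a_def b_def)
  have "continuous_on {a..b} chi" using ab by (intro continuous_on_subset[OF chi]) auto
  then obtain X where X': "\<And>u. u \<in> {a..b} \<Longrightarrow> (X has_vector_derivative chi u) (at u within {a..b})"
    using antiderivative_continuous by blast
  have X: "(X has_real_derivative chi u) (at u)" if "u \<in> {a<..<b}" for u
    using that X'[of u] by (simp add: has_real_derivative_iff_has_vector_derivative at_within_Icc_at)
  have "continuous_on {a..b} (\<lambda>u. exp (X u))"
    using X' by (intro continuous_on_exp continuous_on_vector_derivative) auto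
  then obtain E where E': "\<And>u. u \<in> {a..b} \<Longrightarrow> (E has_vector_derivative exp (X u)) (at u within {a..b})"
    using antiderivative_continuous by blast
  have E: "(E has_real_derivative exp (X u)) (at u)" if "u \<in> {a<..<b}" for u
    using that E'[of u] by (simp add: has_real_derivative_iff_has_vector_derivative at_within_Icc_at)
  let ?L = "\<lambda>y. (ln (\<phi>1 y) + X (F1 y)) - (ln (\<phi>2 y) + X (F2 y))"
  have "(?L has_real_derivative 0) (at y within ?S)" if y: "y \<in> ?S" for y
  proof -
    have "(?L has_real_derivative (\<phi>1' y / \<phi>1 y + chi (F1 y) * \<phi>1 y) - (\<phi>2' y / \<phi>2 y + chi (F2 y) * \<phi>2 y)) (at y)"
      using \<phi>1(2)[of y] \<phi>2(2)[of y]
      by (auto intro!: derivative_eq_intros \<phi>1(1) \<phi>2(1) F1(1) F2(1)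
          DERIV_chain2[where f = X and g = F1, OF X[OF F_ab(1)[OF y]]]
          DERIV_chain2[where f = X and g = F2, OF X[OF F_ab(2)[OF y]]])
    moreover have "(\<phi>1' y / \<phi>1 y + chi (F1 y) * \<phi>1 y) - (\<phi>2' y / \<phi>2 y + chi (F2 y) * \<phi>2 y) = 0"
      using eq[of y] by simp
    ultimately show ?thesis by (simp add: has_field_derivative_at_within)
  qed
  then obtain c where c: "\<And>y. y \<in> ?S \<Longrightarrow> ?L y = c"
    using has_field_derivative_zero_constant[of ?S ?L] by auto
  have R: "x \<in> ?S" "0 \<in> ?S" by (auto simp: R_def)
  have "c = 0" using c[OF R(2)] init by simp
  have \<phi>_eq: "\<phi>1 y * exp (X (F1 y)) = \<phi>2 y * exp (X (F2 y))" if "y \<in> ?S" for y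
  proof -
    have "exp (ln (\<phi>1 y) + X (F1 y)) = exp (ln (\<phi>2 y) + X (F2 y))"
      using c[OF that] \<open>c = 0\<close> by simp
    then show ?thesis using \<phi>1(2)[of y] \<phi>2(2)[of y] by (simp add: exp_add)
  qed
  let ?D = "\<lambda>y. E (F1 y) - E (F2 y)"
  have "(?D has_real_derivative 0) (at y within ?S)" if y: "y \<in> ?S" for y
  proof -
    have "(?D has_real_derivative exp (X (F1 y)) * \<phi>1 y - exp (X (F2 y)) * \<phi>2 y) (at y)"
      by (intro DERIV_diff DERIV_chain2[where f = E and g = F1, OF E[OF F_ab(1)[OF y]]]
          DERIV_chain2[where f = E and g = F2, OF E[OF F_ab(2)[OF y]]] F1 F2)
    then show ?thesis using \<phi>_eq[OF y] by (simp add: has_field_derivative_at_within mult.commute)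
  qed
  then obtain c' where c': "\<And>y. y \<in> ?S \<Longrightarrow> ?D y = c'"
    using has_field_derivative_zero_constant[of ?S ?D] by auto
  have "c' = 0" using c'[OF R(2)] init by simp
  then have Eeq: "E (F1 x) = E (F2 x)" using c'[OF R(1)] by simp
  \<comment> \<open>\<open>E\<close> has the positive derivative exp(X), so equal values of
    \<open>E\<close> have equal arguments.\<close>
  have Emono: "E u < E v" if "u < v" "u \<in> {a<..<b}" "v \<in> {a<..<b}" for u v
  proof (rule DERIV_pos_imp_increasing[OF that(1)])
    show "\<exists>y. (E has_real_derivative y) (at z) \<and> 0 < y" if "u \<le> z" "z \<le> v" for z
      using E[of z] that \<open>u \<in> {a<..<b}\<close> \<open>v \<in> {a<..<b}\<close> by (intro exI[of _ "exp (X z)"]) auto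
  qed
  show ?thesis
    using Emono[OF _ F_ab(1,2)[OF R(1)]] Emono[OF _ F_ab(2,1)[OF R(1)]] Eeq
    by (cases "F1 x" "F2 x" rule: linorder_cases) auto
qed

section \<open>Analytic properties of a regular generator and its margin\<close>

locale regular_margin = marginal_law +
  fixes \<psi> :: "real \<Rightarrow> real"
  assumes d: "2 \<le> d" and regular: "g \<in> regular_generators_lim d \<psi>"
begin

definition "\<gamma> s = enn2real (g s)"
definition "\<phi> t = enn2real (f t)"

lemma g_pos: "0 \<le> s \<Longrightarrow> 0 < g s"
  and g_finite: "0 \<le> s \<Longrightarrow> g s < \<infinity>"
  and \<gamma>_square_differentiable: "(\<lambda>t. \<gamma> (t\<^sup>2)) differentiable at t"
proof -
  have "0 < g (t\<^sup>2)" "g (t\<^sup>2) < \<infinity>" for t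
    using regular by (auto simp: regular_generators_lim_def regular_generator_def)
  from this[of "sqrt s"] show "0 \<le> s \<Longrightarrow> 0 < g s" "0 \<le> s \<Longrightarrow> g s < \<infinity>" by auto
  show "(\<lambda>t. \<gamma> (t\<^sup>2)) differentiable at t"
    using regular by (auto simp: regular_generators_lim_def regular_generator_def \<gamma>_def)
qed

lemma \<gamma>_pos: "0 \<le> s \<Longrightarrow> 0 < \<gamma> s"
  using g_pos[of s] g_finite[of s] by (simp add: \<gamma>_def enn2real_positive_iff)

lemma g_eq_\<gamma>: "0 \<le> s \<Longrightarrow> g s = ennreal (\<gamma> s)"
  using g_finite[of s] by (simp add: \<gamma>_def)

text \<open>Regularity concerns the map sending t to g(t^2). Composing with the square root returns
  to the generator itself, but only for s > 0, where the root is differentiable.\<close>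

lemma \<gamma>_differentiable:
  assumes "0 < s" shows "(\<gamma> has_real_derivative deriv \<gamma> s) (at s)"
proof -
  have "((\<lambda>t. \<gamma> (t\<^sup>2)) \<circ> sqrt) differentiable at s"
  proof (rule differentiable_chain_at)
    show "sqrt differentiable at s"
      using DERIV_real_sqrt[OF assms] by (auto simp: real_differentiable_def)
  qed (rule \<gamma>_square_differentiable)
  then obtain D where "((\<lambda>t. \<gamma> (t\<^sup>2)) \<circ> sqrt has_real_derivative D) (at s)"
    by (auto simp: real_differentiable_def)
  then have "(\<gamma> has_real_derivative D) (at s)"
    by (rule has_field_derivative_transform_within_open[of _ _ _ "{0<..}"]) (use assms in auto)
  then show ?thesis using DERIV_imp_deriv by blast
qed

text \<open>Writing the sum as the square of its root reduces to the map sending t to \<gamma>(t^2),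
  which is continuous at 0 too. Points where the sum vanishes are therefore included.\<close>

lemma continuous_on_\<gamma>_sum:
  assumes "\<And>k. k \<in> A \<Longrightarrow> continuous_on S (\<lambda>x. p k x)"
  shows "continuous_on S (\<lambda>x. \<gamma> (\<Sum>k\<in>A. (p k x)\<^sup>2))"
proof -
  have "continuous_on S (\<lambda>x. (\<lambda>t. \<gamma> (t\<^sup>2)) (sqrt (\<Sum>k\<in>A. (p k x)\<^sup>2)))"
  proof (rule continuous_on_compose2[of UNIV "\<lambda>t. \<gamma> (t\<^sup>2)" S "\<lambda>x. sqrt (\<Sum>k\<in>A. (p k x)\<^sup>2)"])
    show "continuous_on UNIV (\<lambda>t. \<gamma> (t\<^sup>2))"
      using \<gamma>_square_differentiable differentiable_imp_continuous_within
      by (intro continuous_at_imp_continuous_on) blast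
    show "continuous_on S (\<lambda>x. sqrt (\<Sum>k\<in>A. (p k x)\<^sup>2))"
      using assms by (intro continuous_on_real_sqrt continuous_on_sum continuous_on_power)
  qed auto
  then show ?thesis by (simp add: sum_nonneg)
qed

text \<open>The form of the marginal density for which regularity provides finiteness and
  differentiability.\<close>

lemma f_eq_radial:
  "f t = ennreal (pi powr ((real d - 1) / 2) / Gamma ((real d - 1) / 2)) *
    (2 * (\<integral>\<^sup>+r\<in>{0<..}. g (t\<^sup>2 + r\<^sup>2) * ennreal (r ^ (d - 2)) \<partial>lborel))"
proof -
  note [measurable] = borel_measurable_generator_abs[OF generator]
  have e: "real (d - 1) / 2 - 1 = (real d - 3) / 2" "d - 1 - 1 = d - 2"
    using d by (auto simp: of_nat_diff field_simps)
  have "(\<integral>\<^sup>+s\<in>{0<..}. g (t\<^sup>2 + s) * ennreal (s powr ((real d - 3) / 2)) \<partial>lborel) =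
      (\<integral>\<^sup>+s\<in>{0<..}. g \<bar>t\<^sup>2 + s\<bar> * ennreal (s powr ((real d - 3) / 2)) \<partial>lborel)"
    by (intro nn_integral_cong) (auto split: split_indicator)
  also have "\<dots> = 2 * (\<integral>\<^sup>+r\<in>{0<..}. g \<bar>t\<^sup>2 + r\<^sup>2\<bar> * ennreal (r ^ (d - 2)) \<partial>lborel)"
    using nn_integral_powr_substitution_square[of "\<lambda>s. g \<bar>t\<^sup>2 + s\<bar>" "d - 1"] d unfolding e by simp
  finally show ?thesis by (simp add: marginal_density_def)
qed

lemma f_finite: "f t < \<infinity>"
  and \<phi>_differentiable: "(\<phi> has_real_derivative deriv \<phi> t) (at t)"
proof -
  let ?C = "pi powr ((real d - 1) / 2) / Gamma ((real d - 1) / 2)"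
  let ?I = "\<lambda>t. \<integral>\<^sup>+r\<in>{0<..}. g (t\<^sup>2 + r\<^sup>2) * ennreal (r ^ (d - 2)) \<partial>lborel"
  have I: "?I t < \<infinity>" "(\<lambda>t. enn2real (?I t)) differentiable at t" for t
    using regular by (auto simp: regular_generators_lim_def regular_generator_def)
  show "f t < \<infinity>" unfolding f_eq_radial using I(1)[of t] by (auto simp: ennreal_mult_less_top)
  have "\<phi> = (\<lambda>t. ?C * 2 * enn2real (?I t))"
    using marginal_constant_pos[OF d] by (auto simp: fun_eq_iff \<phi>_def f_eq_radial enn2real_mult)
  moreover obtain D where "((\<lambda>t. enn2real (?I t)) has_real_derivative D) (at t)"
    using I(2)[of t] by (auto simp: real_differentiable_def)
  ultimately have "(\<phi> has_real_derivative ?C * 2 * D) (at t)"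
    using DERIV_cmult[of "\<lambda>t. enn2real (?I t)" D t UNIV "?C * 2"] by simp
  then show "(\<phi> has_real_derivative deriv \<phi> t) (at t)"
    using DERIV_imp_deriv by metis
qed

lemma f_eq_\<phi>: "f t = ennreal (\<phi> t)"
  using f_finite[of t] by (simp add: \<phi>_def)

lemma \<phi>_pos: "0 < \<phi> t"
proof -
  have "f t \<noteq> 0"
  proof
    assume "f t = 0"
    then have "AE s in lborel. 0 < s \<longrightarrow> g (t\<^sup>2 + s) = 0"
      using marginal_density_eq_0_iff[OF generator d] by blast
    then have "AE s in lborel. s \<notin> {0<..<1::real}"
    proof eventually_elim
      case (elim s)
      then show ?case using g_pos[of "t\<^sup>2 + s"] by auto
    qed
    then have "emeasure lborel {0<..<1::real} = 0"
      by (subst (asm) AE_iff_measurable[of "{0<..<1}"]) auto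
    then show False by simp
  qed
  then show ?thesis using f_finite[of t] by (simp add: \<phi>_def enn2real_positive_iff zero_less_iff_neq_zero)
qed

lemma F_has_derivative: "(F has_real_derivative \<phi> x) (at x)"
proof -
  let ?a = "x - 1" and ?b = "x + 1"
  have c: "continuous_on S \<phi>" for S
    using \<phi>_differentiable by (intro continuous_at_imp_continuous_on) (blast intro: DERIV_isCont)
  have eq: "F y = F ?a + integral {?a..y} \<phi>" if "?a < y" for y
  proof -
    have I: "(\<phi> has_integral integral {?a..y} \<phi>) {?a..y}"
      by (intro integrable_integral integrable_continuous_interval c)
    have "emeasure (density lborel f) {?a<..y} = (\<integral>\<^sup>+t. f t * indicator {?a<..y} t \<partial>lborel)"
      by (simp add: emeasure_density)
    also have "\<dots> = (\<integral>\<^sup>+t. ennreal (\<phi> t * indicator {?a..y} t) \<partial>lborel)"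
      using AE_lborel_singleton[of ?a]
      by (intro nn_integral_cong_AE, eventually_elim) (auto simp: f_eq_\<phi> split: split_indicator)
    also have "\<dots> = ennreal (integral {?a..y} \<phi>)"
      using nn_integral_has_integral_lebesgue[OF _ I] \<phi>_pos by (simp add: less_imp_le mult.commute)
    finally have "measure (density lborel f) {?a<..y} = integral {?a..y} \<phi>"
      using integral_nonneg[of \<phi> "{?a..y}"] I \<phi>_pos by (auto simp: measure_def less_imp_le)
    then show ?thesis using N.cdf_diff_eq[OF that] by (simp add: cdf_margin)
  qed
  have "((\<lambda>y. F ?a + integral {?a..y} \<phi>) has_real_derivative \<phi> x) (at x within {?a..?b})"
    by (rule derivative_eq_intros integral_has_real_derivative c | simp)+
  then have "((\<lambda>y. F ?a + integral {?a..y} \<phi>) has_real_derivative \<phi> x) (at x)"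
    by (simp add: at_within_Icc_at)
  then show ?thesis
    by (rule has_field_derivative_transform_within_open[of _ _ _ "{?a<..}"]) (auto simp: eq)
qed

lemma F_strict_mono: "x < y \<Longrightarrow> F x < F y"
  using DERIV_pos_imp_increasing[of x y F] F_has_derivative \<phi>_pos by blast

lemma F_pos: "0 < F x" and F_less_1: "F x < 1"
  using F_strict_mono[of "x - 1" x] F_strict_mono[of x "x + 1"] F_bounds[of "x - 1"] F_bounds[of "x + 1"]
  by auto

lemma Q_has_derivative:
  assumes "0 < u" "u < 1" shows "(Q has_real_derivative 1 / \<phi> (Q u)) (at u)"
proof -
  have "(Q has_real_derivative inverse (\<phi> (Q u))) (at u)"
    using F_has_derivative[of "Q u"] \<phi>_pos[of "Q u"] assms
    by (intro DERIV_inverse_function[where a = 0 and b = 1 and f = F]) (auto simp: F_Q isCont_Q[OF d])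
  then show ?thesis by (simp add: field_simps)
qed

text \<open>\<open>F\<close> stays below 1 because the generator is positive on the whole half line.
  Hence v tending to 1 leads to the regime at infinity in which \<psi> is defined.\<close>

lemma Q_at_top: "filterlim Q at_top (at_left 1)"
  unfolding filterlim_at_top
proof
  fix B
  have "eventually (\<lambda>v. v \<in> {F B<..<1}) (at_left 1)"
    using F_less_1[of B] by (intro eventually_at_leftI[of "F B"]) auto
  then show "eventually (\<lambda>v. B \<le> Q v) (at_left 1)"
  proof eventually_elim
    case (elim v)
    then have "\<not> Q v \<le> B" using Q_le_iff[of v B] F_pos[of B] by auto
    then show ?case by simp
  qed
qed

lemma Q_pos: assumes "1 / 2 < v" "v < 1" shows "0 < Q v"
  using Q_le_iff[of v 0] assms by (auto simp: F_0 not_le[symmetric])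

end

section \<open>The differential equation of a regular margin\<close>

lemma regular_margin_cart:
  assumes "g \<in> regular_generators_lim CARD('n::finite) \<psi>" "2 \<le> CARD('n)"
  shows "regular_margin CARD('n) g \<psi>" "density_generator CARD('n) g"
proof -
  show dg: "density_generator CARD('n) g"
    using assms by (auto simp: regular_generators_lim_def regular_generator_def)
  show "regular_margin CARD('n) g \<psi>"
    by (intro regular_margin.intro regular_margin_axioms.intro marginal_law_spherical dg assms)
qed

text \<open>For v > 1/2, \<open>c\<close> is a multiple of the slice density of \<open>g1\<close>,
  by a factor constant in the first argument. The derivative of ln c, assumed to exist through
  \<open>g\<close>, can thus be computed by the chain rule from \<open>g1\<close>.\<close>

lemma regular_margin_ode:
  fixes g g1 :: "real \<Rightarrow> ennreal" and U :: "'a \<Rightarrow> real^'n" and i j :: 'n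
  assumes card: "2 \<le> CARD('n)" and ij: "i \<noteq> j"
    and dg: "density_generator CARD('n) g" and U: "meta_elliptical M U (mat 1) g"
    and cdef: "\<And>u v. c u v = meta_elliptical_density (mat 1) g (slice_point i j u v)"
    and c: "\<And>u v. u \<in> {0<..<1} \<Longrightarrow> v \<in> {0<..<1} \<Longrightarrow>
           0 < c u v \<and> c u v < \<infinity> \<and> (\<lambda>x. ln (enn2real (c x v))) differentiable at u"
    and chi: "\<And>u. u \<in> {0<..<1} \<Longrightarrow>
           ((\<lambda>v. deriv (\<lambda>x. ln (enn2real (c x v))) u) \<longlongrightarrow> chi u) (at_left 1)"
    and reg: "g1 \<in> regular_generators_lim CARD('n) \<psi>" and U1: "meta_elliptical M U (mat 1) g1"
  shows "chi (marginal_cdf CARD('n) g1 x) * regular_margin.\<phi> CARD('n) g1 x +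
    deriv (regular_margin.\<phi> CARD('n) g1) x / regular_margin.\<phi> CARD('n) g1 x = 2 * x * \<psi> (x\<^sup>2)"
proof -
  interpret regular_margin "CARD('n)" g1 \<psi> by (rule regular_margin_cart) fact+
  have dg1: "density_generator CARD('n) g1" by (rule regular_margin_cart) fact+
  let ?cube = "{w :: real^'n. \<forall>k. 0 < w $ k \<and> w $ k < 1}"
  define K where "K w = \<gamma> (\<Sum>k\<in>UNIV. (Q (w $ k))\<^sup>2) / (\<Prod>k\<in>UNIV. \<phi> (Q (w $ k)))" for w :: "real^'n"
  have K: "enn2real (meta_elliptical_density (mat 1) g1 w) = K w" for w :: "real^'n"
    unfolding meta_elliptical_density_mat_1 f_eq_\<phi> K_def
    using \<phi>_pos by (subst prod_ennreal) (auto simp: less_imp_le enn2real_divide_ennreal prod_pos \<gamma>_def)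
  have Qc: "continuous_on ?cube (\<lambda>w. Q (w $ k))" for k
  proof (rule continuous_on_compose2[of "{0<..<1}" Q])
    show "continuous_on {0<..<1} Q"
      using isCont_Q[OF card] by (intro continuous_at_imp_continuous_on) auto
  qed (auto intro!: continuous_intros)
  have "continuous_on UNIV \<phi>"
    using \<phi>_differentiable by (intro continuous_at_imp_continuous_on) (blast intro: DERIV_isCont)
  then have "continuous_on ?cube (\<lambda>w. \<phi> (Q (w $ k)))" for k
    by (rule continuous_on_compose2[OF _ Qc]) simp
  then have Kc: "continuous_on ?cube K"
    unfolding K_def using \<phi>_pos
    by (intro continuous_on_divide continuous_on_\<gamma>_sum Qc continuous_on_prod) (auto simp: less_imp_neq[symmetric])
  have AE: "AE w in lborel. w \<in> ?cube \<longrightarrow> enn2real (meta_elliptical_density (mat 1) g w) = K w"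
    using AE_meta_elliptical_density_eq[OF card dg U dg1 U1] by eventually_elim (auto simp: K)
  \<comment> \<open>Differentiability is given for ln c; since \<open>c\<close> is positive and
    finite near \<open>u\<close>, applying exp yields continuity of \<open>c\<close> itself.\<close>
  have ccont: "isCont (\<lambda>x. enn2real (c x v)) u" if "0 < u" "u < 1" "0 < v" "v < 1" for u v
  proof -
    have "isCont (\<lambda>x. exp (ln (enn2real (c x v)))) u"
      using c[of u v] that differentiable_imp_continuous_within[of "\<lambda>x. ln (enn2real (c x v))" u UNIV]
      by (intro isCont_o2[OF _ isCont_exp]) auto
    moreover have "eventually (\<lambda>x. x \<in> {0<..<1}) (nhds u)"
      using that by (intro eventually_nhds_in_open) auto
    then have "eventually (\<lambda>x. exp (ln (enn2real (c x v))) = enn2real (c x v)) (nhds u)"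
      by eventually_elim (use c that in \<open>auto simp: enn2real_positive_iff\<close>)
    ultimately show ?thesis by (simp add: isCont_cong)
  qed
  note ratio = slice_density_ratio[OF card dg ij cdef _ _ Kc AE]
  define u where "u = F x"
  have u: "0 < u" "u < 1" using F_pos F_less_1 by (auto simp: u_def)
  have Qu: "Q u = x" using Q_F[OF card] F_pos F_less_1 by (simp add: u_def)
  define P where "P = (\<Prod>k\<in>UNIV - {i, j}. \<phi> 0)"
  have P: "0 < P" unfolding P_def using \<phi>_pos by (intro prod_pos) auto
  have Kslice: "K (slice_point i j s v) = \<gamma> ((Q s)\<^sup>2 + (Q v)\<^sup>2) / (\<phi> (Q s) * \<phi> (Q v) * P)" for s v
    unfolding K_def sum_slice_point[OF ij, where \<phi> = "\<lambda>t. (Q t)\<^sup>2"]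
      prod_slice_point[OF ij, where \<phi> = "\<lambda>t. \<phi> (Q t)"]
    by (simp add: Q_half[OF card] P_def)
  have Kpos: "0 < K (slice_point i j s v)" for s v
    unfolding Kslice using P \<phi>_pos \<gamma>_pos by (intro divide_pos_pos mult_pos_pos) auto
  \<comment> \<open>The logarithmic derivative of the slice density of \<open>g1\<close> at u =
    F(x), with \<open>y\<close> in place of \<open>Q v\<close>. The outer division by \<phi>(x) is
    the derivative of \<open>Q\<close> at \<open>u\<close>.\<close>
  define \<Phi> where "\<Phi> y = (2 * x * (deriv \<gamma> (x\<^sup>2 + y\<^sup>2) / \<gamma> (x\<^sup>2 + y\<^sup>2)) - deriv \<phi> x / \<phi> x) / \<phi> x" for y
  have "deriv (\<lambda>x. ln (enn2real (c x v))) u = \<Phi> (Q v)" if v: "1 / 2 < v" "v < 1" for v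
  proof -
    have v': "0 < v" using v by simp
    \<comment> \<open>\<open>ratio\<close> compares any two first arguments. Fixing one of them at
      \<open>u\<close> makes \<alpha> constant in \<open>s\<close>, so it drops out on
      differentiation.\<close>
    define \<alpha> where "\<alpha> = enn2real (c u v) / K (slice_point i j u v)"
    have S: "0 < enn2real (c s v)" if "0 < s" "s < 1" for s
      using c[of s v] that v v' by (simp add: enn2real_positive_iff)
    have \<alpha>: "0 < \<alpha>" unfolding \<alpha>_def using S[OF u] Kpos by simp
    have eq: "ln (enn2real (c s v)) = ln \<alpha> + (ln (\<gamma> ((Q s)\<^sup>2 + (Q v)\<^sup>2)) - ln (\<phi> (Q s)) - ln (\<phi> (Q v) * P))"
      if s: "0 < s" "s < 1" for s
    proof -
      have "enn2real (c s v) * K (slice_point i j u v) = enn2real (c u v) * K (slice_point i j s v)"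
        using c by (intro ratio ccont s u v) auto
      then have "enn2real (c s v) = \<alpha> * K (slice_point i j s v)"
        using Kpos[of u v] by (simp add: \<alpha>_def field_simps)
      then show ?thesis
        using \<alpha> P \<phi>_pos[of "Q s"] \<phi>_pos[of "Q v"] \<gamma>_pos[of "(Q s)\<^sup>2 + (Q v)\<^sup>2"] Kpos[of s v]
        by (simp add: ln_mult ln_div Kslice)
    qed
    \<comment> \<open>Positivity of \<open>Q v\<close> keeps the argument of \<gamma> away from 0,
      even for x = 0; differentiability of \<gamma> is established only on positive
      arguments.\<close>
    have pos: "0 < x\<^sup>2 + (Q v)\<^sup>2" using Q_pos[OF v] by (intro add_nonneg_pos) auto
    have Q': "(Q has_real_derivative 1 / \<phi> x) (at u)" using Q_has_derivative[OF u] by (simp add: Qu)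
    have g': "((\<lambda>s. \<gamma> ((Q s)\<^sup>2 + (Q v)\<^sup>2)) has_real_derivative
        deriv \<gamma> (x\<^sup>2 + (Q v)\<^sup>2) * (2 * x * (1 / \<phi> x))) (at u)"
    proof (rule DERIV_chain2[where f = \<gamma> and g = "\<lambda>s. (Q s)\<^sup>2 + (Q v)\<^sup>2"])
      show "(\<gamma> has_real_derivative deriv \<gamma> (x\<^sup>2 + (Q v)\<^sup>2)) (at ((Q u)\<^sup>2 + (Q v)\<^sup>2))"
        using \<gamma>_differentiable[OF pos] by (simp add: Qu)
      show "((\<lambda>s. (Q s)\<^sup>2 + (Q v)\<^sup>2) has_real_derivative 2 * x * (1 / \<phi> x)) (at u)"
        by (auto intro!: derivative_eq_intros Q' simp: Qu)
    qed
    have f': "((\<lambda>s. \<phi> (Q s)) has_real_derivative deriv \<phi> x * (1 / \<phi> x)) (at u)"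
    proof (rule DERIV_chain2[where f = \<phi> and g = Q])
      show "(\<phi> has_real_derivative deriv \<phi> x) (at (Q u))"
        using \<phi>_differentiable[of x] by (simp add: Qu)
    qed (rule Q')
    have "((\<lambda>s. ln \<alpha> + (ln (\<gamma> ((Q s)\<^sup>2 + (Q v)\<^sup>2)) - ln (\<phi> (Q s)) - ln (\<phi> (Q v) * P)))
        has_real_derivative \<Phi> (Q v)) (at u)"
      using \<gamma>_pos[of "x\<^sup>2 + (Q v)\<^sup>2"] \<phi>_pos[of x]
      by (auto intro!: derivative_eq_intros g' f' simp: Qu \<Phi>_def field_simps)
    then have "((\<lambda>s. ln (enn2real (c s v))) has_real_derivative \<Phi> (Q v)) (at u)"
      by (rule has_field_derivative_transform_within_open[of _ _ _ "{0<..<1}"]) (use u eq in auto)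
    then show ?thesis by (rule DERIV_imp_deriv)
  qed
  moreover have "eventually (\<lambda>v. v \<in> {1 / 2<..<1 :: real}) (at_left 1)"
    by (rule eventually_at_leftI[of "1 / 2"]) auto
  ultimately have ev: "eventually (\<lambda>v. deriv (\<lambda>x. ln (enn2real (c x v))) u = \<Phi> (Q v)) (at_left 1)"
    by (auto elim!: eventually_mono)
  have "((\<lambda>y. deriv \<gamma> (x\<^sup>2 + y\<^sup>2) / \<gamma> (x\<^sup>2 + y\<^sup>2)) \<longlongrightarrow> \<psi> (x\<^sup>2)) at_top"
    using reg unfolding regular_generators_lim_def \<gamma>_def[abs_def] by blast
  then have "(\<Phi> \<longlongrightarrow> (2 * x * \<psi> (x\<^sup>2) - deriv \<phi> x / \<phi> x) / \<phi> x) at_top"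
    unfolding \<Phi>_def using \<phi>_pos[of x] by (intro tendsto_intros) auto
  then have "((\<lambda>v. \<Phi> (Q v)) \<longlongrightarrow> (2 * x * \<psi> (x\<^sup>2) - deriv \<phi> x / \<phi> x) / \<phi> x) (at_left 1)"
    by (rule filterlim_compose[OF _ Q_at_top])
  then have "((\<lambda>v. deriv (\<lambda>x. ln (enn2real (c x v))) u) \<longlongrightarrow> (2 * x * \<psi> (x\<^sup>2) - deriv \<phi> x / \<phi> x) / \<phi> x) (at_left 1)"
    using tendsto_cong[OF ev] by blast
  then have "chi u = (2 * x * \<psi> (x\<^sup>2) - deriv \<phi> x / \<phi> x) / \<phi> x"
    using chi[of u] u by (intro tendsto_unique[of "at_left 1"]) auto
  then show ?thesis using \<phi>_pos[of x] by (simp add: u_def field_simps)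
qed

section \<open>From equal margins to equal generators\<close>

lemma locally_lipschitz_on_imp_continuous_on:
  assumes "locally_lipschitz_on S f" "open S"
  shows "continuous_on S f"
proof (rule continuous_at_imp_continuous_on, rule ballI)
  fix x assume "x \<in> S"
  then obtain r L where r: "0 < r" and L: "L-lipschitz_on (ball x r \<inter> S) f"
    using assms by (auto simp: locally_lipschitz_on_def)
  have "continuous_on (ball x r \<inter> S) f" using L by (rule lipschitz_on_continuous_on)
  then show "isCont f x"
    using r \<open>x \<in> S\<close> \<open>open S\<close> by (subst (asm) continuous_on_eq_continuous_at) auto
qed

text \<open>The law of \<open>U\<close> and the common quantile function determine a single
  spherical law. Its two densities agree a priori almost everywhere; continuity of both generators,
  also at 0, makes them agree at every squared norm.\<close>

lemma regular_generator_eq: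
  fixes U :: "'a \<Rightarrow> real^'n"
  assumes card: "2 \<le> CARD('n)"
    and reg1: "g1 \<in> regular_generators_lim CARD('n) \<psi>" and U1: "meta_elliptical M U (mat 1) g1"
    and reg2: "g2 \<in> regular_generators_lim CARD('n) \<psi>" and U2: "meta_elliptical M U (mat 1) g2"
    and F: "marginal_cdf CARD('n) g1 = marginal_cdf CARD('n) g2" and t: "0 \<le> t"
  shows "g1 t = g2 t"
proof -
  interpret R1: regular_margin "CARD('n)" g1 \<psi> by (rule regular_margin_cart) fact+
  interpret R2: regular_margin "CARD('n)" g2 \<psi> by (rule regular_margin_cart) fact+
  have dg: "density_generator CARD('n) g1" "density_generator CARD('n) g2"
    using regular_margin_cart reg1 reg2 card by blast+
  have "R1.quantile = R2.quantile"
    by (simp add: fun_eq_iff R1.quantile_def R2.quantile_def marginal_quantile_def F)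
  then have "elliptical 0 (mat 1 :: real^'n^'n) g1 = elliptical 0 (mat 1) g2"
    using meta_elliptical_distr_quantile(2)[OF correlation_matrix_mat_1 dg(1) card U1]
      meta_elliptical_distr_quantile(2)[OF correlation_matrix_mat_1 dg(2) card U2] by simp
  then have "AE x in (lborel :: (real^'n) measure). g1 (x \<bullet> x) = g2 (x \<bullet> x)"
    unfolding elliptical_mat_1
    by (intro sigma_finite_measure.density_unique[OF sigma_finite_lborel])
      (auto intro!: borel_measurable_generator_comp R1.generator R2.generator)
  then have AE: "AE x in (lborel :: (real^'n) measure). x \<in> UNIV \<longrightarrow>
      R1.\<gamma> (\<Sum>k\<in>UNIV. (x $ k)\<^sup>2) = R2.\<gamma> (\<Sum>k\<in>UNIV. (x $ k)\<^sup>2)"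
    by eventually_elim (simp add: R1.\<gamma>_def R2.\<gamma>_def inner_vec_def power2_eq_square)
  define k0 :: 'n where "k0 = (SOME k. True)"
  define x0 :: "real^'n" where "x0 = axis k0 (sqrt t)"
  have "R1.\<gamma> (\<Sum>k\<in>UNIV. (x0 $ k)\<^sup>2) = R2.\<gamma> (\<Sum>k\<in>UNIV. (x0 $ k)\<^sup>2)"
    using AE_lborel_eq_imp_eq[OF open_UNIV _ _ AE, of x0]
    by (simp add: R1.continuous_on_\<gamma>_sum R2.continuous_on_\<gamma>_sum continuous_on_component)
  moreover have "(\<Sum>k\<in>UNIV. (x0 $ k)\<^sup>2) = t"
    using t by (simp add: x0_def axis_def if_distrib[where f = "\<lambda>x. x\<^sup>2"] cong: if_cong)
  ultimately show ?thesis
    using R1.g_eq_\<gamma>[OF t] R2.g_eq_\<gamma>[OF t] by simp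
qed

theorem proposition4:
  fixes M :: "'a measure"
    and U :: "'a \<Rightarrow> real^'n"
    and i j :: 'n
    and g g1 g2 :: "real \<Rightarrow> ennreal"
    and \<Sigma>1 \<Sigma>2 :: "real^'n^'n"
    and c :: "real \<Rightarrow> real \<Rightarrow> ennreal"
    and chi \<psi> :: "real \<Rightarrow> real"
    and b :: real
  assumes "CARD('n) \<ge> 2" and "i \<noteq> j"
    and "density_generator CARD('n) g"
    and "meta_elliptical M U (mat 1) g"
    and "\<And>u v. c u v = meta_elliptical_density (mat 1) g (slice_point i j u v)"
    and "\<And>u v. u \<in> {0<..<1} \<Longrightarrow> v \<in> {0<..<1} \<Longrightarrow>
           0 < c u v \<and> c u v < \<infinity> \<and> (\<lambda>x. ln (enn2real (c x v))) differentiable at u"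
    and "\<And>u. u \<in> {0<..<1} \<Longrightarrow>
           ((\<lambda>v. deriv (\<lambda>x. ln (enn2real (c x v))) u) \<longlongrightarrow> chi u) (at_left 1)"
    and "locally_lipschitz_on {0<..<1} chi"
    and "\<psi> \<in> borel_measurable (restrict_space borel {0..})"
    and "b > 0"
    and "correlation_matrix \<Sigma>1" and "correlation_matrix \<Sigma>2"
    and "g1 \<in> regular_generators_lim CARD('n) \<psi>"
    and "g2 \<in> regular_generators_lim CARD('n) \<psi>"
    and "meta_elliptical M U \<Sigma>1 g1" and "meta_elliptical M U \<Sigma>2 g2"
    and "ennreal b = ennreal (pi powr ((real CARD('n) - 1) / 2) / Gamma ((real CARD('n) - 1) / 2)) *
           (\<integral>\<^sup>+s\<in>{0<..}. g1 s * ennreal (s powr ((real CARD('n) - 3) / 2)) \<partial>lborel)"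
    and "ennreal b = ennreal (pi powr ((real CARD('n) - 1) / 2) / Gamma ((real CARD('n) - 1) / 2)) *
           (\<integral>\<^sup>+s\<in>{0<..}. g2 s * ennreal (s powr ((real CARD('n) - 3) / 2)) \<partial>lborel)"
  shows "\<Sigma>1 = \<Sigma>2 \<and> (\<forall>t\<ge>0. g1 t = g2 t)"
proof -
  note card = assms(1) and reg1 = assms(13) and reg2 = assms(14)
  interpret R1: regular_margin "CARD('n)" g1 \<psi> by (rule regular_margin_cart) fact+
  interpret R2: regular_margin "CARD('n)" g2 \<psi> by (rule regular_margin_cart) fact+
  have dg: "density_generator CARD('n) g1" "density_generator CARD('n) g2"
    using regular_margin_cart reg1 reg2 card by blast+
  have \<Sigma>: "\<Sigma>1 = mat 1" "\<Sigma>2 = mat 1"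
    using meta_elliptical_independent_correlation[OF card assms(3,4,11) dg(1) R1.g_pos assms(15)]
      meta_elliptical_independent_correlation[OF card assms(3,4,12) dg(2) R2.g_pos assms(16)] by auto
  then have U: "meta_elliptical M U (mat 1) g1" "meta_elliptical M U (mat 1) g2"
    using assms(15,16) by auto
  have "marginal_density CARD('n) g1 0 = ennreal b"
    unfolding assms(17) by (simp add: marginal_density_def)
  moreover have "marginal_density CARD('n) g2 0 = ennreal b"
    unfolding assms(18) by (simp add: marginal_density_def)
  ultimately have init: "R1.\<phi> 0 = b" "R2.\<phi> 0 = b"
    using \<open>b > 0\<close> by (simp_all add: R1.\<phi>_def R2.\<phi>_def)
  have chi: "continuous_on {0<..<1} chi"
    by (rule locally_lipschitz_on_imp_continuous_on[OF assms(8)]) simp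
  have ode: "chi (marginal_cdf CARD('n) h x) * regular_margin.\<phi> CARD('n) h x +
      deriv (regular_margin.\<phi> CARD('n) h) x / regular_margin.\<phi> CARD('n) h x = 2 * x * \<psi> (x\<^sup>2)"
    if "h \<in> regular_generators_lim CARD('n) \<psi>" "meta_elliptical M U (mat 1) h" for h x
    by (rule regular_margin_ode[OF card assms(2-5) _ _ that]) (fact assms(6) assms(7))+
  have "marginal_cdf CARD('n) g1 x = marginal_cdf CARD('n) g2 x" for x
    by (rule second_order_ode_unique[OF R1.F_has_derivative R1.F_pos R1.F_less_1
          R2.F_has_derivative R2.F_pos R2.F_less_1 R1.\<phi>_differentiable R1.\<phi>_pos
          R2.\<phi>_differentiable R2.\<phi>_pos _ _ chi])
      (simp_all add: R1.F_0 R2.F_0 init ode[OF reg1 U(1)] ode[OF reg2 U(2)])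
  then have "marginal_cdf CARD('n) g1 = marginal_cdf CARD('n) g2" by (rule ext)
  then show ?thesis using \<Sigma> regular_generator_eq[OF card reg1 U(1) reg2 U(2)] by simp
qed

end
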